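(* Let $G$ be a finite group, $u\in\Omega(G)^\times$ and $N\trianglelefteq G$. Then $$s_N(u)=\begin{cases}\varphi_N^{G}(u),&\chi_N^u=1_{G/N},\\ 0,&\chi_N^u\neq 1_{G/N}.\end{cases}$$
   Context: For a finite group $G$, $\Omega(G)$ is the Burnside ring (Grothendieck ring of finite $G$-sets), with $\mathbb Z$-basis $[G/H]$, $(H)$ running over the conjugacy classes of subgroups of $G$. For $K\le G$, the mark $\varphi_K^G:\Omega(G)\to\mathbb Z$ is the ring homomorphism $[X]\mapsto\#X^K$; every mark of a unit is $\pm1$. With $\operatorname{core}_G(H)=\bigcap_{g\in G}gHg^{-1}$, for $x=\sum_{(H)}a_H[G/H]\in\Omega(G)$ and $N\trianglelefteq G$ put $c_N(x)=\sum_{(H):\,\operatorname{core}_G(H)=N}a_H$ and $s_N(x)=\sum_{N\le M\trianglelefteq G}c_M(x)$. For $u\in\Omega(G)^\times$ and $N\trianglelefteq G$, the Yoshida character $\chi_N^u:G/N\to\{\pm1\}$ is $\chi_N^u(gN)=\varphi^G_{\langle N,g\rangle}(u)/\varphi_N^G(u)$; by Yoshida's known unit criterion (for every $u\in\Omega(G)^\times$ and $H\le G$ the map $N_G(H)/H\to\{\pm1\}$, $gH\mapsto\varphi^G_{\langle H,g\rangle}(u)/\varphi_H^G(u)$ is a group homomorphism), $\chi_N^u$ is a group homomorphism. $1_{G/N}$ denotes the trivial homomorphism. *)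

theory Defs
  imports "HOL-Algebra.Ring" "HOL-Algebra.Group_Action" "HOL-Algebra.Generated_Groups"
    "HOL-Algebra.Left_Coset"
begin

section \<open>Finite \<open>G\<close>-sets\<close>

text \<open>A \<open>G\<close>-set is a pair of a carrier set and an action. As in \<^locale>\<open>group_action\<close>, the maps
  given by group elements are extensional on the carrier set, hence the restrictions below.\<close>

type_synonym ('a, 'x) gset = "'x set \<times> ('a \<Rightarrow> 'x \<Rightarrow> 'x)"

definition fin_gset :: "('a, 'm) monoid_scheme \<Rightarrow> ('a, 'x) gset \<Rightarrow> bool" where
  "fin_gset G X \<longleftrightarrow> finite (fst X) \<and> group_action G (fst X) (snd X)"

definition gset_iso :: "('a, 'm) monoid_scheme \<Rightarrow> ('a, 'x) gset \<Rightarrow> ('a, 'y) gset \<Rightarrow> bool" where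
  "gset_iso G X Y \<longleftrightarrow> (\<exists>f. bij_betw f (fst X) (fst Y) \<and>
     (\<forall>g\<in>carrier G. \<forall>x\<in>fst X. f (snd X g x) = snd Y g (f x)))"

definition gset_sum :: "('a, 'x) gset \<Rightarrow> ('a, 'y) gset \<Rightarrow> ('a, 'x + 'y) gset" where
  "gset_sum X Y = (Sum_Type.Plus (fst X) (fst Y),
     \<lambda>g. restrict (map_sum (snd X g) (snd Y g)) (Sum_Type.Plus (fst X) (fst Y)))"

definition gset_prod :: "('a, 'x) gset \<Rightarrow> ('a, 'y) gset \<Rightarrow> ('a, 'x \<times> 'y) gset" where
  "gset_prod X Y = (fst X \<times> fst Y, \<lambda>g. restrict (map_prod (snd X g) (snd Y g)) (fst X \<times> fst Y))"

definition gset_empty :: "('a, nat) gset" where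
  "gset_empty = ({}, \<lambda>g. \<lambda>x\<in>{}. x)"

definition gset_point :: "('a, nat) gset" where
  "gset_point = ({0}, \<lambda>g. \<lambda>x\<in>{0}. x)"

definition gset_coset :: "('a, 'm) monoid_scheme \<Rightarrow> 'a set \<Rightarrow> ('a, 'a set) gset" where
  "gset_coset G H = (lcosets\<^bsub>G\<^esub> H, \<lambda>g. \<lambda>C\<in>lcosets\<^bsub>G\<^esub> H. g <#\<^bsub>G\<^esub> C)"

definition fixed_points :: "('a, 'x) gset \<Rightarrow> 'a set \<Rightarrow> 'x set" where
  "fixed_points X K = (\<Inter>k\<in>K. invariants (fst X) (snd X) k) \<inter> fst X"


section \<open>The Burnside ring\<close>

text \<open>The Grothendieck ring of finite \<open>G\<close>-sets. Every finite \<open>G\<close>-set is isomorphic to one whose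
  carrier is a set of natural numbers, so an element of the ring is represented as an equivalence
  class of pairs (formal differences) of such \<open>G\<close>-sets. The class \<open>[X] - [Y]\<close> itself is defined
  for finite \<open>G\<close>-sets \<open>X\<close>, \<open>Y\<close> over arbitrary types.\<close>

type_synonym 'a virtual_gset = "(('a, nat) gset \<times> ('a, nat) gset) set"

definition gdiff :: "('a, 'm) monoid_scheme \<Rightarrow> ('a, 'x) gset \<Rightarrow> ('a, 'y) gset \<Rightarrow> 'a virtual_gset" where
  "gdiff G X Y = {(S, T). fin_gset G S \<and> fin_gset G T \<and>
     (\<exists>Z :: ('a, nat) gset. fin_gset G Z \<and>
        gset_iso G (gset_sum (gset_sum X T) Z) (gset_sum (gset_sum S Y) Z))}"

definition gclass :: "('a, 'm) monoid_scheme \<Rightarrow> ('a, 'x) gset \<Rightarrow> 'a virtual_gset" where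
  "gclass G X = gdiff G X gset_empty"

text \<open>The operations are defined on representatives; as usual for quotients, the union runs over
  sets that all coincide.\<close>

definition burnside_ring :: "('a, 'm) monoid_scheme \<Rightarrow> 'a virtual_gset ring" where
  "burnside_ring G =
    \<lparr>carrier = {gdiff G X Y | (X :: ('a, nat) gset) (Y :: ('a, nat) gset). fin_gset G X \<and> fin_gset G Y},
     monoid.mult = (\<lambda>A B. \<Union>(X, Y)\<in>A. \<Union>(X', Y')\<in>B.
       gdiff G (gset_sum (gset_prod X X') (gset_prod Y Y'))
               (gset_sum (gset_prod X Y') (gset_prod Y X'))),
     one = gclass G gset_point,
     zero = gclass G gset_empty,
     add = (\<lambda>A B. \<Union>(X, Y)\<in>A. \<Union>(X', Y')\<in>B. gdiff G (gset_sum X X') (gset_sum Y Y'))\<rparr>"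

text \<open>The mark at \<open>K\<close>: the additive extension of \<open>[X] \<mapsto> #X\<^sup>K\<close>, which does not depend on the
  representative.\<close>

definition mark :: "'a set \<Rightarrow> 'a virtual_gset \<Rightarrow> int" where
  "mark K x = the_elem ((\<lambda>(X, Y). int (card (fixed_points X K)) - int (card (fixed_points Y K))) ` x)"


section \<open>Coefficients in the basis of transitive \<open>G\<close>-sets\<close>

definition conj_class :: "('a, 'm) monoid_scheme \<Rightarrow> 'a set \<Rightarrow> 'a set set" where
  "conj_class G H = (\<lambda>g. g <#\<^bsub>G\<^esub> H #>\<^bsub>G\<^esub> inv\<^bsub>G\<^esub> g) ` carrier G"

definition subgroup_classes :: "('a, 'm) monoid_scheme \<Rightarrow> 'a set set set" where
  "subgroup_classes G = conj_class G ` {H. subgroup H G}"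

text \<open>A subgroup representing its conjugacy class; the class \<open>[G/H]\<close> depends only on \<open>(H)\<close>.\<close>

definition class_rep :: "'a set set \<Rightarrow> 'a set" where
  "class_rep C = (SOME H. H \<in> C)"

text \<open>The family of coefficients \<open>a\<^sub>H\<close> with \<open>x = \<Sum> a\<^sub>H [G/H]\<close>; it exists and is unique for finite
  \<open>G\<close> because the classes \<open>[G/H]\<close> form a \<open>\<int>\<close>-basis.\<close>

definition burnside_coeff :: "('a, 'm) monoid_scheme \<Rightarrow> 'a virtual_gset \<Rightarrow> 'a set set \<Rightarrow> int" where
  "burnside_coeff G x = (THE a. a \<in> subgroup_classes G \<rightarrow>\<^sub>E UNIV \<and>
     x = finsum (burnside_ring G)
           (\<lambda>C. add_pow (burnside_ring G) (a C) (gclass G (gset_coset G (class_rep C))))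
           (subgroup_classes G))"

definition core :: "('a, 'm) monoid_scheme \<Rightarrow> 'a set \<Rightarrow> 'a set" where
  "core G H = (\<Inter>g\<in>carrier G. g <#\<^bsub>G\<^esub> H #>\<^bsub>G\<^esub> inv\<^bsub>G\<^esub> g)"

definition core_coeff :: "('a, 'm) monoid_scheme \<Rightarrow> 'a set \<Rightarrow> 'a virtual_gset \<Rightarrow> int" where
  "core_coeff G N x =
     (\<Sum>C\<in>{C \<in> subgroup_classes G. core G (class_rep C) = N}. burnside_coeff G x C)"

definition core_sum :: "('a, 'm) monoid_scheme \<Rightarrow> 'a set \<Rightarrow> 'a virtual_gset \<Rightarrow> int" where
  "core_sum G N x = (\<Sum>M\<in>{M. M \<lhd> G \<and> N \<subseteq> M}. core_coeff G M x)"


section \<open>Yoshida characters\<close>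

text \<open>The value at a coset is the common value of the quotient for all of its elements \<open>g\<close>. For a
  unit \<open>u\<close> all marks are \<open>\<plusminus>1\<close>, so the integer division is exact.\<close>

definition yoshida_char ::
  "('a, 'm) monoid_scheme \<Rightarrow> 'a virtual_gset \<Rightarrow> 'a set \<Rightarrow> 'a set \<Rightarrow> int" where
  "yoshida_char G u N = (\<lambda>C\<in>carrier (G Mod N).
     the_elem ((\<lambda>g. mark (generate G (N \<union> {g})) u div mark N u) ` C))"

definition trivial_char :: "('a, 'm) monoid_scheme \<Rightarrow> 'a set \<Rightarrow> 'a set \<Rightarrow> int" where
  "trivial_char G N = (\<lambda>C\<in>carrier (G Mod N). 1)"

end

theory Submission
  imports Defs
begin

text \<open>A finite \<open>G\<close>-set is determined up to isomorphism by the numbers of its points with a given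
  stabilizer \<open>H\<close>. Hence a virtual \<open>G\<close>-set is the same thing as an integer function \<open>f\<close> on
  subgroups (a difference of such counts), and \<open>\<phi>\<^sub>K(u) = (\<Sum>H \<supseteq> K. f H)\<close>.

  Since \<open>core\<^sub>G(H) \<supseteq> N\<close> iff \<open>H \<supseteq> N\<close>, the integer \<open>s\<^sub>N(u)\<close> is the virtual number of orbits on
  the \<open>N\<close>-fixed points of \<open>u\<close>, so by orbit counting it is the average of the marks
  \<open>\<phi>\<^sub>\<langle>\<^sub>N\<^sub>,\<^sub>g\<^sub>\<rangle>(u)\<close> over \<open>g \<in> G\<close>. All of these are \<open>\<plusminus>1\<close> for a unit \<open>u\<close>. If they agree, the average
  is their common value \<open>\<phi>\<^sub>N(u)\<close>; otherwise the average is an integer of absolute value less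
  than \<open>1\<close>. Integrality thus replaces Yoshida's criterion that \<open>\<chi>\<close> is a homomorphism.\<close>

section \<open>Point counts by stabilizer\<close>

text \<open>Indexed by the subgroup itself and not by its conjugacy class, so no representatives
  have to be chosen; integer valued, so that differences can be formed freely.\<close>

definition stab_count :: "('a, 'm) monoid_scheme \<Rightarrow> ('a, 'x) gset \<Rightarrow> 'a set \<Rightarrow> int" where
  "stab_count G X H = int (card {x \<in> fst X. stabilizer G (snd X) x = H})"

text \<open>The action maps are cut down together with the carrier because actions are extensional;
  the result is again a G-set when \<open>A\<close> is invariant.\<close>

definition gset_restrict :: "('a, 'x) gset \<Rightarrow> 'x set \<Rightarrow> ('a, 'x) gset" where
  "gset_restrict X A = (A, \<lambda>g. restrict (snd X g) A)"

section \<open>Finite G-sets, invariant subsets and stabilizer counts\<close>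

context group
begin

text \<open>Bijectivity comes from the group: the map of \<open>inv g\<close> is a two-sided inverse
  of the map of \<open>g\<close> on \<open>E\<close>.\<close>

lemma group_actionI:
  assumes ext: "\<And>g. g \<in> carrier G \<Longrightarrow> \<phi> g \<in> extensional E"
    and closed: "\<And>g x. \<lbrakk>g \<in> carrier G; x \<in> E\<rbrakk> \<Longrightarrow> \<phi> g x \<in> E"
    and one: "\<And>x. x \<in> E \<Longrightarrow> \<phi> \<one> x = x"
    and mult: "\<And>g h x. \<lbrakk>g \<in> carrier G; h \<in> carrier G; x \<in> E\<rbrakk> \<Longrightarrow> \<phi> (g \<otimes> h) x = \<phi> g (\<phi> h x)"
  shows "group_action G E \<phi>"
proof -
  have bij: "\<phi> g \<in> Bij E" if g: "g \<in> carrier G" for g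
  proof -
    have "\<phi> (inv g) (\<phi> g x) = x" "\<phi> g (\<phi> (inv g) x) = x" if "x \<in> E" for x
      using mult[of "inv g" g x] mult[of g "inv g" x] one that g by simp_all
    then have "bij_betw (\<phi> g) E E"
      using closed g by (intro bij_betw_byWitness[where f' = "\<phi> (inv g)"]) auto
    then show ?thesis
      using ext[OF g] by (simp add: Bij_def)
  qed
  have "group_hom G (BijGroup E) \<phi>"
  proof (intro group_hom.intro group_hom_axioms.intro group_BijGroup homI)
    show "group G" ..
    show "\<phi> g \<in> carrier (BijGroup E)" if "g \<in> carrier G" for g
      using bij that by (simp add: BijGroup_def)
    fix g h assume gh: "g \<in> carrier G" "h \<in> carrier G"
    have "\<phi> (g \<otimes> h) = compose E (\<phi> g) (\<phi> h)"
      using ext[of "g \<otimes> h"] mult gh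
      by (intro extensionalityI[of _ E]) (auto simp: compose_def)
    then show "\<phi> (g \<otimes> h) = \<phi> g \<otimes>\<^bsub>BijGroup E\<^esub> \<phi> h"
      using bij gh by (simp add: BijGroup_def)
  qed
  then show ?thesis
    by (rule group_action.intro)
qed

lemma fin_gsetI:
  assumes "finite (fst X)"
    and "\<And>g. g \<in> carrier G \<Longrightarrow> snd X g \<in> extensional (fst X)"
    and "\<And>g x. \<lbrakk>g \<in> carrier G; x \<in> fst X\<rbrakk> \<Longrightarrow> snd X g x \<in> fst X"
    and "\<And>x. x \<in> fst X \<Longrightarrow> snd X \<one> x = x"
    and "\<And>g h x. \<lbrakk>g \<in> carrier G; h \<in> carrier G; x \<in> fst X\<rbrakk> \<Longrightarrow> snd X (g \<otimes> h) x = snd X g (snd X h x)"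
  shows "fin_gset G X"
  using assms by (auto simp: fin_gset_def intro: group_actionI)

lemma fin_gsetD:
  assumes "fin_gset G X"
  shows "finite (fst X)"
    and "\<And>g. g \<in> carrier G \<Longrightarrow> snd X g \<in> extensional (fst X)"
    and "\<And>g x. \<lbrakk>g \<in> carrier G; x \<in> fst X\<rbrakk> \<Longrightarrow> snd X g x \<in> fst X"
    and "\<And>x. x \<in> fst X \<Longrightarrow> snd X \<one> x = x"
    and "\<And>g h x. \<lbrakk>g \<in> carrier G; h \<in> carrier G; x \<in> fst X\<rbrakk> \<Longrightarrow> snd X (g \<otimes> h) x = snd X g (snd X h x)"
    and "\<And>x. x \<in> fst X \<Longrightarrow> subgroup (stabilizer G (snd X) x) G"
proof -
  interpret group_action G "fst X" "snd X"
    using assms by (simp add: fin_gset_def)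
  show "finite (fst X)"
    using assms by (simp add: fin_gset_def)
  show "\<And>g. g \<in> carrier G \<Longrightarrow> snd X g \<in> extensional (fst X)"
    using bij_prop0 by (simp add: Bij_def)
  show "\<And>g x. \<lbrakk>g \<in> carrier G; x \<in> fst X\<rbrakk> \<Longrightarrow> snd X g x \<in> fst X"
    using element_image by blast
  show "\<And>x. x \<in> fst X \<Longrightarrow> snd X \<one> x = x"
    by (metis id_eq_one restrict_apply')
  show "\<And>g h x. \<lbrakk>g \<in> carrier G; h \<in> carrier G; x \<in> fst X\<rbrakk> \<Longrightarrow> snd X (g \<otimes> h) x = snd X g (snd X h x)"
    using composition_rule by blast
  show "\<And>x. x \<in> fst X \<Longrightarrow> subgroup (stabilizer G (snd X) x) G"
    using stabilizer_subgroup by blast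
qed

lemma fin_gset_inv_cancel:
  assumes "fin_gset G X" "g \<in> carrier G" "x \<in> fst X"
  shows "snd X (inv g) (snd X g x) = x" "snd X g (snd X (inv g) x) = x"
  using fin_gsetD(5)[OF assms(1), of "inv g" g x] fin_gsetD(5)[OF assms(1), of g "inv g" x]
    fin_gsetD(4)[OF assms(1)] assms(2,3) by simp_all

lemma fin_gset_restrict:
  assumes "fin_gset G X" "A \<subseteq> fst X" "\<And>g x. \<lbrakk>g \<in> carrier G; x \<in> A\<rbrakk> \<Longrightarrow> snd X g x \<in> A"
  shows "fin_gset G (gset_restrict X A)"
  using assms fin_gsetD[OF assms(1)]
  by (intro fin_gsetI) (auto simp: gset_restrict_def subset_iff intro: finite_subset)

text \<open>Whether \<open>g\<close> fixes \<open>x\<close> is tested at \<open>x\<close> alone, so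
  cutting down the carrier leaves stabilizers unchanged and the count splits over \<open>A\<close>
  and its complement.\<close>

lemma stab_count_restrict:
  assumes "fin_gset G X" "A \<subseteq> fst X"
  shows "stab_count G X H =
    stab_count G (gset_restrict X A) H + stab_count G (gset_restrict X (fst X - A)) H"
proof -
  let ?S = "\<lambda>B. {x \<in> B. stabilizer G (snd X) x = H}"
  have *: "stab_count G (gset_restrict X B) H = int (card (?S B))" if "B \<subseteq> fst X" for B
  proof -
    have "stabilizer G (snd (gset_restrict X B)) x = stabilizer G (snd X) x" if "x \<in> B" for x
      using that by (simp add: stabilizer_def gset_restrict_def)
    then have "{x \<in> fst (gset_restrict X B). stabilizer G (snd (gset_restrict X B)) x = H} = ?S B"
      by (auto simp: gset_restrict_def)
    then show ?thesis
      by (simp add: stab_count_def)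
  qed
  have "card (?S (fst X)) = card (?S A \<union> ?S (fst X - A))"
    using assms(2) by (intro arg_cong[of _ _ card]) auto
  also have "\<dots> = card (?S A) + card (?S (fst X - A))"
    using assms(2) fin_gsetD(1)[OF assms(1)]
    by (intro card_Un_disjoint) (auto intro: rev_finite_subset)
  finally show ?thesis
    using * assms(2) by (simp add: stab_count_def[of G X])
qed

text \<open>An injective equivariant map preserves stabilizers, so \<open>f\<close> matches the
  points with stabilizer \<open>H\<close> on both sides.\<close>

lemma stab_count_iso:
  assumes "gset_iso G X Y" and "fin_gset G X"
  shows "stab_count G X H = stab_count G Y H"
proof -
  obtain f where f: "bij_betw f (fst X) (fst Y)"
    and eq: "\<And>g x. \<lbrakk>g \<in> carrier G; x \<in> fst X\<rbrakk> \<Longrightarrow> f (snd X g x) = snd Y g (f x)"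
    using assms(1) by (auto simp: gset_iso_def)
  have "stabilizer G (snd Y) (f x) = stabilizer G (snd X) x" if "x \<in> fst X" for x
  proof -
    have "snd Y g (f x) = f x \<longleftrightarrow> snd X g x = x" if "g \<in> carrier G" for g
      using eq[OF that \<open>x \<in> fst X\<close>] bij_betw_imp_inj_on[OF f] \<open>x \<in> fst X\<close>
        fin_gsetD(3)[OF assms(2) that \<open>x \<in> fst X\<close>] by (metis inj_on_contraD)
    then show ?thesis
      by (auto simp: stabilizer_def)
  qed
  then have "bij_betw f {x \<in> fst X. stabilizer G (snd X) x = H} {y \<in> fst Y. stabilizer G (snd Y) y = H}"
    using bij_betw_imp_inj_on[OF f] bij_betw_imp_surj_on[OF f, symmetric]
    by (intro bij_betw_subset[OF f]) (auto intro!: imageI)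
  then show ?thesis
    by (simp add: stab_count_def bij_betw_same_card)
qed

text \<open>Ring elements are represented by G-sets on natural numbers, while coset spaces live on
  another type. Numbering the points and transporting the action bridges the gap.\<close>

lemma ex_nat_gset:
  assumes "fin_gset G X"
  shows "\<exists>Y :: ('a, nat) gset. fin_gset G Y \<and> stab_count G Y = stab_count G X"
proof -
  obtain f :: "'c \<Rightarrow> nat" and n where f: "bij_betw f (fst X) {0..<n}"
    using ex_bij_betw_finite_nat[OF fin_gsetD(1)[OF assms]] by blast
  define k where "k = inv_into (fst X) f"
  have k: "\<And>x. x \<in> fst X \<Longrightarrow> k (f x) = x" "\<And>i. i < n \<Longrightarrow> f (k i) = i \<and> k i \<in> fst X"
    "\<And>x. x \<in> fst X \<Longrightarrow> f x < n"
    using f bij_betw_inv_into_left[OF f] bij_betw_inv_into_right[OF f]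
      bij_betw_apply[OF bij_betw_inv_into[OF f]] bij_betw_apply[OF f] by (auto simp: k_def)
  define Y :: "('a, nat) gset" where "Y = ({0..<n}, \<lambda>g. \<lambda>i\<in>{0..<n}. f (snd X g (k i)))"
  have Y: "fin_gset G Y"
    using k fin_gsetD[OF assms] by (intro fin_gsetI) (auto simp: Y_def)
  have "gset_iso G X Y"
    unfolding gset_iso_def using f k by (intro exI[of _ f]) (auto simp: Y_def)
  with Y show ?thesis
    using stab_count_iso[OF _ assms] by fastforce
qed

section \<open>Classification of finite G-sets by their orbits\<close>

text \<open>Sending the \<open>g\<close>-translate of \<open>x\<close> to the
  \<open>g\<close>-translate of \<open>y\<close> is well defined and injective: \<open>g\<close> and
  \<open>h\<close> give the same translate exactly if \<open>inv h \<otimes> g\<close> lies in the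
  common stabilizer.\<close>

lemma gset_iso_orbit:
  assumes X: "fin_gset G X" and Y: "fin_gset G Y" and x: "x \<in> fst X" and y: "y \<in> fst Y"
    and stab: "stabilizer G (snd X) x = stabilizer G (snd Y) y"
  shows "gset_iso G (gset_restrict X (orbit G (snd X) x)) (gset_restrict Y (orbit G (snd Y) y))"
proof -
  have key: "snd X g x = snd X h x \<longleftrightarrow> snd Y g y = snd Y h y"
    if gh: "g \<in> carrier G" "h \<in> carrier G" for g h
  proof -
    have aux: "snd Z g z = snd Z h z \<longleftrightarrow> inv h \<otimes> g \<in> stabilizer G (snd Z) z"
      if Z: "fin_gset G Z" and z: "z \<in> fst Z" for Z :: "('a, 'z) gset" and z
    proof -
      have "snd Z (inv h \<otimes> g) z = snd Z (inv h) (snd Z g z)"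
        using fin_gsetD(5)[OF Z _ _ z] gh by simp
      moreover have "snd Z h (snd Z (inv h) (snd Z g z)) = snd Z g z"
        "snd Z (inv h) (snd Z h z) = z"
        using fin_gset_inv_cancel[OF Z] fin_gsetD(3)[OF Z] gh z by simp_all
      ultimately show ?thesis
        using gh by (auto simp: stabilizer_def)
    qed
    show ?thesis
      using aux[OF X x] aux[OF Y y] stab by simp
  qed
  \<comment> \<open>Some \<open>g\<close> carrying \<open>x\<close> to \<open>z\<close> is chosen;
    by \<open>key\<close> the value does not depend on the choice.\<close>
  define f where "f z = snd Y (SOME g. g \<in> carrier G \<and> snd X g x = z) y" for z
  have f: "f (snd X g x) = snd Y g y" if "g \<in> carrier G" for g
  proof -
    let ?P = "\<lambda>h. h \<in> carrier G \<and> snd X h x = snd X g x"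
    have "?P (SOME h. ?P h)"
      by (rule someI[of ?P g]) (simp add: that)
    then show ?thesis
      using key that by (auto simp: f_def)
  qed
  have "bij_betw f (orbit G (snd X) x) (orbit G (snd Y) y)"
    by (auto simp: bij_betw_def inj_on_def orbit_def f key image_iff) (metis f)
  moreover have "snd X g z \<in> orbit G (snd X) x \<and> f z \<in> orbit G (snd Y) y \<and> f (snd X g z) = snd Y g (f z)"
    if g: "g \<in> carrier G" and z: "z \<in> orbit G (snd X) x" for g z
  proof -
    obtain h where h: "h \<in> carrier G" "z = snd X h x"
      using z by (auto simp: orbit_def)
    then have gz: "snd X g z = snd X (g \<otimes> h) x"
      using fin_gsetD(5)[OF X] g x by simp
    then have "f (snd X g z) = snd Y g (f z)"
      using gz f fin_gsetD(5)[OF Y] h g y by simp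
    then show ?thesis
      using h gz f g by (auto simp: orbit_def)
  qed
  ultimately show ?thesis
    unfolding gset_iso_def by (intro exI[of _ f]) (auto simp: gset_restrict_def)
qed

text \<open>The complement of an orbit is invariant too, since \<open>inv g\<close> would carry a
  translate inside the orbit back into it. Inductions can therefore split off one orbit.\<close>

lemma orbit_invariant:
  assumes X: "fin_gset G X" and x: "x \<in> fst X"
  shows "x \<in> orbit G (snd X) x" "orbit G (snd X) x \<subseteq> fst X"
    "\<And>g z. \<lbrakk>g \<in> carrier G; z \<in> orbit G (snd X) x\<rbrakk> \<Longrightarrow> snd X g z \<in> orbit G (snd X) x"
    "\<And>g z. \<lbrakk>g \<in> carrier G; z \<in> fst X - orbit G (snd X) x\<rbrakk> \<Longrightarrow> snd X g z \<in> fst X - orbit G (snd X) x"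
proof -
  show "x \<in> orbit G (snd X) x"
    using fin_gsetD(4)[OF X x] by (auto simp: orbit_def intro!: exI[of _ \<one>])
  show "orbit G (snd X) x \<subseteq> fst X"
    using fin_gsetD(3)[OF X] x by (auto simp: orbit_def)
  show cl: "snd X g z \<in> orbit G (snd X) x" if g: "g \<in> carrier G" and z: "z \<in> orbit G (snd X) x" for g z
  proof -
    obtain h where h: "h \<in> carrier G" "z = snd X h x"
      using z by (auto simp: orbit_def)
    then have "snd X g z = snd X (g \<otimes> h) x"
      using fin_gsetD(5)[OF X] g x by simp
    then show ?thesis
      using h g by (auto simp: orbit_def)
  qed
  show "snd X g z \<in> fst X - orbit G (snd X) x"
    if "g \<in> carrier G" "z \<in> fst X - orbit G (snd X) x" for g z
    using cl[of "inv g" "snd X g z"] that fin_gset_inv_cancel[OF X] fin_gsetD(3)[OF X] by auto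
qed

text \<open>The two isomorphisms are joined by cases on membership in \<open>A\<close>; by
  invariance a point and its translates fall under the same case, which gives equivariance.\<close>

lemma gset_iso_glue:
  assumes iso: "gset_iso G (gset_restrict X A) (gset_restrict Y B)"
      "gset_iso G (gset_restrict X (fst X - A)) (gset_restrict Y (fst Y - B))"
    and sub: "A \<subseteq> fst X" "B \<subseteq> fst Y"
    and inv: "\<And>g x. \<lbrakk>g \<in> carrier G; x \<in> A\<rbrakk> \<Longrightarrow> snd X g x \<in> A"
      "\<And>g x. \<lbrakk>g \<in> carrier G; x \<in> fst X - A\<rbrakk> \<Longrightarrow> snd X g x \<in> fst X - A"
  shows "gset_iso G X Y"
proof -
  have *: "\<exists>f. bij_betw f A' B' \<and> (\<forall>g\<in>carrier G. \<forall>x\<in>A'. f (snd X g x) = snd Y g (f x))"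
    if iso: "gset_iso G (gset_restrict X A') (gset_restrict Y B')" for A' B'
  proof -
    obtain f where f: "bij_betw f A' B'"
      "\<And>g x. \<lbrakk>g \<in> carrier G; x \<in> A'\<rbrakk> \<Longrightarrow>
        f (restrict (snd X g) A' x) = restrict (snd Y g) B' (f x)"
      using iso unfolding gset_iso_def gset_restrict_def fst_conv snd_conv by blast
    then show ?thesis
      using bij_betw_apply[OF f(1)] by (intro exI[of _ f]) auto
  qed
  obtain f where f: "bij_betw f A B"
    "\<And>g x. \<lbrakk>g \<in> carrier G; x \<in> A\<rbrakk> \<Longrightarrow> f (snd X g x) = snd Y g (f x)"
    using *[OF iso(1)] by blast
  obtain f' where f': "bij_betw f' (fst X - A) (fst Y - B)"
    "\<And>g x. \<lbrakk>g \<in> carrier G; x \<in> fst X - A\<rbrakk> \<Longrightarrow> f' (snd X g x) = snd Y g (f' x)"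
    using *[OF iso(2)] by blast
  define h where "h = (\<lambda>x. if x \<in> A then f x else f' x)"
  have "bij_betw h (A \<union> (fst X - A)) (B \<union> (fst Y - B))"
    unfolding h_def using f(1) f'(1) by (intro bij_betw_disjoint_Un) auto
  then have "bij_betw h (fst X) (fst Y)"
    using sub by (simp add: Un_absorb1)
  then show ?thesis
    unfolding gset_iso_def using f(2) f'(2) inv by (intro exI[of _ h]) (auto simp: h_def)
qed

text \<open>Induction on the number of points. Equal counts provide \<open>x\<close> and
  \<open>y\<close> with the same stabilizer; their orbits are isomorphic, and removing both keeps
  the remaining counts equal.\<close>

lemma gset_isoI_stab_count:
  assumes "fin_gset G X" "fin_gset G Y" "stab_count G X = stab_count G Y"
  shows "gset_iso G X Y"
  using assms
proof (induction "card (fst X)" arbitrary: X Y rule: less_induct)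
  case less
  note X = less.prems(1) and Y = less.prems(2)
  have count: "card {x \<in> fst X. stabilizer G (snd X) x = H} = card {y \<in> fst Y. stabilizer G (snd Y) y = H}" for H
    using fun_cong[OF less.prems(3), of H] by (simp add: stab_count_def)
  \<comment> \<open>Stated for an arbitrary pair of G-sets because it is applied in both directions:
    from \<open>Y\<close> to \<open>X\<close> if \<open>X\<close> is empty, from \<open>X\<close> to
    \<open>Y\<close> otherwise.\<close>
  have ex: "\<exists>b\<in>fst B. stabilizer G (snd B) b = stabilizer G (snd A) a"
    if "a \<in> fst A" "fin_gset G A"
      "\<And>H. card {x \<in> fst A. stabilizer G (snd A) x = H} = card {y \<in> fst B. stabilizer G (snd B) y = H}"
    for A :: "('a, 'u) gset" and B :: "('a, 'v) gset" and a
  proof -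
    have "card {x \<in> fst A. stabilizer G (snd A) x = stabilizer G (snd A) a} \<noteq> 0"
      using that(1) fin_gsetD(1)[OF that(2)] by auto
    then have "card {y \<in> fst B. stabilizer G (snd B) y = stabilizer G (snd A) a} \<noteq> 0"
      unfolding that(3) .
    then have "{y \<in> fst B. stabilizer G (snd B) y = stabilizer G (snd A) a} \<noteq> {}"
      by (rule contrapos_nn) (simp only: card.empty)
    then show ?thesis
      by blast
  qed
  show ?case
  proof (cases "fst X = {}")
    case True
    then have "fst Y = {}"
      using ex[OF _ Y count[symmetric]] by blast
    with True show ?thesis
      by (auto simp: gset_iso_def bij_betw_def)
  next
    case False
    then obtain x where x: "x \<in> fst X"
      by blast
    obtain y where y: "y \<in> fst Y" and st: "stabilizer G (snd X) x = stabilizer G (snd Y) y"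
      using ex[OF x X count] by metis
    let ?A = "orbit G (snd X) x" and ?B = "orbit G (snd Y) y"
    note oX = orbit_invariant[OF X x] and oY = orbit_invariant[OF Y y]
    have iso: "gset_iso G (gset_restrict X ?A) (gset_restrict Y ?B)"
      using gset_iso_orbit[OF X Y x y st] .
    have fX: "fin_gset G (gset_restrict X (fst X - ?A))" "fin_gset G (gset_restrict X ?A)"
      using oX by (auto intro!: fin_gset_restrict[OF X])
    have fY: "fin_gset G (gset_restrict Y (fst Y - ?B))"
      using oY by (auto intro!: fin_gset_restrict[OF Y])
    have "stab_count G (gset_restrict X (fst X - ?A)) H = stab_count G (gset_restrict Y (fst Y - ?B)) H" for H
      using stab_count_restrict[OF X oX(2), of H] stab_count_restrict[OF Y oY(2), of H]
        stab_count_iso[OF iso fX(2), of H] fun_cong[OF less.prems(3), of H] by linarith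
    moreover have "card (fst (gset_restrict X (fst X - ?A))) < card (fst X)"
      using x oX(1) fin_gsetD(1)[OF X] by (auto simp: gset_restrict_def intro!: psubset_card_mono)
    ultimately have "gset_iso G (gset_restrict X (fst X - ?A)) (gset_restrict Y (fst Y - ?B))"
      using less.hyps fX(1) fY by blast
    then show ?thesis
      using gset_iso_glue[OF iso _ oX(2) oY(2) oX(3,4)] by blast
  qed
qed

lemma gset_iso_iff:
  assumes "fin_gset G X" "fin_gset G Y"
  shows "gset_iso G X Y \<longleftrightarrow> stab_count G X = stab_count G Y"
  using gset_isoI_stab_count stab_count_iso assms by blast

end

section \<open>The additive group of the Burnside ring\<close>

text \<open>The ring element with difference of counts \<open>f\<close>, as a set of representing
  pairs; it is empty if no pair has this difference.\<close>

definition vclass :: "('a, 'm) monoid_scheme \<Rightarrow> ('a set \<Rightarrow> int) \<Rightarrow> 'a virtual_gset" where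
  "vclass G f = {(S, T). fin_gset G S \<and> fin_gset G T \<and>
     (\<forall>H. stab_count G S H - stab_count G T H = f H)}"

text \<open>The additive group of the Burnside ring as a group of integer functions: on it
  \<open>vclass\<close> is injective, outside it \<open>vclass\<close> is constantly empty.\<close>

definition virtual_counts :: "('a, 'm) monoid_scheme \<Rightarrow> ('a set \<Rightarrow> int) set" where
  "virtual_counts G = {f. vclass G f \<noteq> {}}"

section \<open>Sums, products and fixed points of finite G-sets\<close>

context group
begin

lemma fin_gset_sum:
  assumes "fin_gset G X" "fin_gset G Y"
  shows "fin_gset G (gset_sum X Y)"
  using fin_gsetD[OF assms(1)] fin_gsetD[OF assms(2)]
  by (intro fin_gsetI) (auto simp: gset_sum_def)

lemma stab_count_sum:
  assumes "fin_gset G X" "fin_gset G Y"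
  shows "stab_count G (gset_sum X Y) H = stab_count G X H + stab_count G Y H"
proof -
  let ?S = "\<lambda>Z. {x \<in> fst Z. stabilizer G (snd Z) x = H}"
  have "stabilizer G (snd (gset_sum X Y)) (Inl x) = stabilizer G (snd X) x" if "x \<in> fst X" for x
    using that InlI[OF that, of "fst Y"] by (simp add: gset_sum_def stabilizer_def)
  moreover have "stabilizer G (snd (gset_sum X Y)) (Inr y) = stabilizer G (snd Y) y" if "y \<in> fst Y" for y
    using that InrI[OF that, of "fst X"] by (simp add: gset_sum_def stabilizer_def)
  moreover have "fst (gset_sum X Y) = Sum_Type.Plus (fst X) (fst Y)"
    by (simp add: gset_sum_def)
  ultimately have "?S (gset_sum X Y) = Sum_Type.Plus (?S X) (?S Y)"
    by auto
  then show ?thesis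
    using fin_gsetD(1)[OF assms(1)] fin_gsetD(1)[OF assms(2)]
    by (simp add: stab_count_def card_Plus)
qed

lemma fin_gset_prod:
  assumes "fin_gset G X" "fin_gset G Y"
  shows "fin_gset G (gset_prod X Y)"
  using fin_gsetD[OF assms(1)] fin_gsetD[OF assms(2)]
  by (intro fin_gsetI) (auto simp: gset_prod_def)

lemma fin_gset_empty: "fin_gset G gset_empty"
  by (intro fin_gsetI) (auto simp: gset_empty_def)

lemma stab_count_empty: "stab_count G gset_empty H = 0"
  by (simp add: stab_count_def gset_empty_def)

lemma fin_gset_point: "fin_gset G gset_point"
  by (intro fin_gsetI) (auto simp: gset_point_def)

text \<open>Points are grouped by their stabilizer. Weight \<open>1\<close> counts fixed points;
  weight \<open>card H\<close> serves the orbit counting.\<close>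

lemma sum_stab_count:
  assumes "fin_gset G X" "finite (carrier G)"
  shows "(\<Sum>H | subgroup H G \<and> P H. w H * stab_count G X H) =
    (\<Sum>x | x \<in> fst X \<and> P (stabilizer G (snd X) x). w (stabilizer G (snd X) x))"
proof -
  let ?st = "stabilizer G (snd X)"
  have "{H. subgroup H G \<and> P H} \<subseteq> Pow (carrier G)"
    by (auto dest: subgroup.subset)
  then have "finite {H. subgroup H G \<and> P H}"
    using assms(2) finite_subset by blast
  then have "(\<Sum>x | x \<in> fst X \<and> P (?st x). w (?st x)) =
    (\<Sum>H | subgroup H G \<and> P H. \<Sum>x\<in>{x \<in> {x \<in> fst X. P (?st x)}. ?st x = H}. w (?st x))"
    using fin_gsetD(1,6)[OF assms(1)] by (intro sum.group[symmetric]) auto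
  also have "\<dots> = (\<Sum>H | subgroup H G \<and> P H. w H * stab_count G X H)"
  proof (intro sum.cong refl)
    fix H assume "H \<in> {H. subgroup H G \<and> P H}"
    then have "{x \<in> {x \<in> fst X. P (?st x)}. ?st x = H} = {x \<in> fst X. ?st x = H}"
      by auto
    then show "(\<Sum>x\<in>{x \<in> {x \<in> fst X. P (?st x)}. ?st x = H}. w (?st x)) = w H * stab_count G X H"
      by (simp add: stab_count_def)
  qed
  finally show ?thesis ..
qed

lemma fixed_points_eq:
  assumes "K \<subseteq> carrier G"
  shows "fixed_points X K = {x \<in> fst X. K \<subseteq> stabilizer G (snd X) x}"
  using assms by (auto simp: fixed_points_def invariants_def stabilizer_def)

text \<open>A point is fixed by \<open>K\<close> exactly if \<open>K\<close> lies in its stabilizer;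
  marks thereby become sums of counts.\<close>

lemma card_fixed_points:
  assumes "fin_gset G X" "finite (carrier G)" "K \<subseteq> carrier G"
  shows "int (card (fixed_points X K)) = (\<Sum>H | subgroup H G \<and> K \<subseteq> H. stab_count G X H)"
  using sum_stab_count[OF assms(1,2), where P = "\<lambda>H. K \<subseteq> H" and w = "\<lambda>_. 1"] assms(3)
  by (simp add: fixed_points_eq)

lemma card_fixed_points_prod:
  "card (fixed_points (gset_prod X Y) K) = card (fixed_points X K) * card (fixed_points Y K)"
proof -
  have "fixed_points (gset_prod X Y) K = fixed_points X K \<times> fixed_points Y K"
    by (auto simp: fixed_points_def invariants_def gset_prod_def)
  then show ?thesis
    by (simp add: card_cartesian_product)
qed

lemma card_fixed_points_point: "card (fixed_points gset_point K) = 1"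
proof -
  have "fixed_points gset_point K = {0}"
    by (auto simp: fixed_points_def invariants_def gset_point_def)
  then show ?thesis
    by simp
qed

section \<open>The additive structure in terms of counts\<close>

text \<open>By the classification an isomorphism is an equality of counts. Counts add over disjoint
  unions and integers cancel, so the summand \<open>Z\<close> drops out.\<close>

lemma gdiff_eq_vclass:
  assumes "fin_gset G X" "fin_gset G Y"
  shows "gdiff G X Y = vclass G (\<lambda>H. stab_count G X H - stab_count G Y H)"
proof -
  have "(S, T) \<in> gdiff G X Y \<longleftrightarrow> (S, T) \<in> vclass G (\<lambda>H. stab_count G X H - stab_count G Y H)"
    if "fin_gset G S" "fin_gset G T" for S T :: "('a, nat) gset"
  proof -
    have "gset_iso G (gset_sum (gset_sum X T) Z) (gset_sum (gset_sum S Y) Z) \<longleftrightarrow>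
        (\<forall>H. stab_count G X H + stab_count G T H = stab_count G S H + stab_count G Y H)"
      if "fin_gset G Z" for Z :: "('a, nat) gset"
      using that \<open>fin_gset G S\<close> \<open>fin_gset G T\<close> assms
      by (subst gset_iso_iff) (auto simp: fin_gset_sum stab_count_sum fun_eq_iff)
    \<comment> \<open>For the direction from counts to \<open>gdiff\<close>, the empty G-set serves
      as \<open>Z\<close>.\<close>
    then have "(S, T) \<in> gdiff G X Y \<longleftrightarrow>
        (\<forall>H. stab_count G X H + stab_count G T H = stab_count G S H + stab_count G Y H)"
      using that fin_gset_empty unfolding gdiff_def by blast
    also have "\<dots> \<longleftrightarrow> (S, T) \<in> vclass G (\<lambda>H. stab_count G X H - stab_count G Y H)"
      using that by (auto simp: vclass_def algebra_simps)
    finally show ?thesis .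
  qed
  moreover have "fin_gset G S \<and> fin_gset G T"
    if "(S, T) \<in> gdiff G X Y \<or> (S, T) \<in> vclass G (\<lambda>H. stab_count G X H - stab_count G Y H)" for S T
    using that unfolding gdiff_def vclass_def by blast
  ultimately show ?thesis
    by (intro equalityI subrelI) blast+
qed

lemma stab_count_diff_virtual:
  assumes "fin_gset G X" "fin_gset G Y"
  shows "(\<lambda>H. stab_count G X H - stab_count G Y H) \<in> virtual_counts G"
proof -
  obtain S T :: "('a, nat) gset" where "fin_gset G S" "stab_count G S = stab_count G X"
    "fin_gset G T" "stab_count G T = stab_count G Y"
    using ex_nat_gset[OF assms(1)] ex_nat_gset[OF assms(2)] by blast
  then have "(S, T) \<in> vclass G (\<lambda>H. stab_count G X H - stab_count G Y H)"
    by (simp add: vclass_def)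
  then show ?thesis
    by (auto simp: virtual_counts_def)
qed

lemma virtual_countsE:
  assumes "f \<in> virtual_counts G"
  obtains S T where "(S, T) \<in> vclass G f" "fin_gset G S" "fin_gset G T"
    "f = (\<lambda>H. stab_count G S H - stab_count G T H)"
proof -
  obtain S T where S: "(S, T) \<in> vclass G f"
    using assms by (fastforce simp: virtual_counts_def)
  then have "fin_gset G S" "fin_gset G T" "f = (\<lambda>H. stab_count G S H - stab_count G T H)"
    by (auto simp: vclass_def)
  with S show ?thesis
    by (rule that)
qed

text \<open>A single common representing pair determines the function; membership in
  \<open>virtual_counts G\<close> supplies one.\<close>

lemma vclass_inject:
  assumes "vclass G f = vclass G g" "f \<in> virtual_counts G"
  shows "f = g"
proof -
  obtain S T where "(S, T) \<in> vclass G f" "(S, T) \<in> vclass G g"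
    using assms(1) virtual_countsE[OF assms(2)] by metis
  then show ?thesis
    by (auto simp: vclass_def fun_eq_iff)
qed

lemma carrier_burnside:
  "carrier (burnside_ring G) = vclass G ` virtual_counts G"
proof (intro equalityI subsetI)
  fix A assume "A \<in> carrier (burnside_ring G)"
  then obtain X Y :: "('a, nat) gset" where X: "fin_gset G X" "fin_gset G Y" "A = gdiff G X Y"
    by (auto simp: burnside_ring_def)
  then show "A \<in> vclass G ` virtual_counts G"
    using gdiff_eq_vclass[OF X(1,2)] stab_count_diff_virtual[OF X(1,2)] by simp
next
  fix A assume "A \<in> vclass G ` virtual_counts G"
  then obtain f where A: "A = vclass G f" and f: "f \<in> virtual_counts G"
    by blast
  obtain S T :: "('a, nat) gset" where S: "fin_gset G S" "fin_gset G T"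
    "f = (\<lambda>H. stab_count G S H - stab_count G T H)"
    using virtual_countsE[OF f] by metis
  then have "A = gdiff G S T"
    using A gdiff_eq_vclass[OF S(1,2)] by simp
  with S show "A \<in> carrier (burnside_ring G)"
    unfolding burnside_ring_def partial_object.simps by blast
qed

text \<open>Counts add over disjoint unions, so every choice of representatives gives the same
  class. The unions in the definition of addition run over nonempty sets and collapse to it.\<close>

lemma add_burnside:
  assumes "f \<in> virtual_counts G" "g \<in> virtual_counts G"
  shows "vclass G f \<oplus>\<^bsub>burnside_ring G\<^esub> vclass G g = vclass G (\<lambda>H. f H + g H)"
    and "(\<lambda>H. f H + g H) \<in> virtual_counts G"
proof -
  have *: "gdiff G (gset_sum X X') (gset_sum Y Y') = vclass G (\<lambda>H. f H + g H)
      \<and> (\<lambda>H. f H + g H) \<in> virtual_counts G"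
    if "(X, Y) \<in> vclass G f" "(X', Y') \<in> vclass G g" for X Y X' Y'
  proof -
    have fin: "fin_gset G X" "fin_gset G Y" "fin_gset G X'" "fin_gset G Y'"
      using that by (auto simp: vclass_def)
    have "f = (\<lambda>H. stab_count G X H - stab_count G Y H)"
      "g = (\<lambda>H. stab_count G X' H - stab_count G Y' H)"
      using that by (auto simp: vclass_def)
    then have "(\<lambda>H. f H + g H) =
        (\<lambda>H. stab_count G (gset_sum X X') H - stab_count G (gset_sum Y Y') H)"
      using fin by (simp add: stab_count_sum algebra_simps)
    then show ?thesis
      using gdiff_eq_vclass[of "gset_sum X X'" "gset_sum Y Y'"]
        stab_count_diff_virtual[of "gset_sum X X'" "gset_sum Y Y'"] fin
        fin_gset_sum[of X X'] fin_gset_sum[of Y Y'] by simp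
  qed
  obtain X Y X' Y' where ne: "(X, Y) \<in> vclass G f" "(X', Y') \<in> vclass G g"
    using virtual_countsE assms by metis
  then show "(\<lambda>H. f H + g H) \<in> virtual_counts G"
    using * by blast
  show "vclass G f \<oplus>\<^bsub>burnside_ring G\<^esub> vclass G g = vclass G (\<lambda>H. f H + g H)" (is "_ = ?R")
  proof -
    have "vclass G f \<oplus>\<^bsub>burnside_ring G\<^esub> vclass G g = (\<Union>p\<in>vclass G f. \<Union>q\<in>vclass G g. ?R)"
      unfolding burnside_ring_def ring_record_simps using *
      by (intro SUP_cong refl) (simp add: case_prod_beta)
    also have "\<dots> = ?R"
      using assms by (simp add: virtual_counts_def)
    finally show ?thesis .
  qed
qed

lemma zero_burnside: "\<zero>\<^bsub>burnside_ring G\<^esub> = vclass G (\<lambda>H. 0)"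
  using gdiff_eq_vclass[OF fin_gset_empty fin_gset_empty]
  by (simp add: burnside_ring_def gclass_def)

lemma zero_virtual: "(\<lambda>H. 0) \<in> virtual_counts G"
  using stab_count_diff_virtual[OF fin_gset_empty fin_gset_empty] by simp

lemma uminus_virtual:
  assumes "f \<in> virtual_counts G"
  shows "(\<lambda>H. - f H) \<in> virtual_counts G"
proof -
  obtain S T where "(S, T) \<in> vclass G f"
    using virtual_countsE assms by metis
  then have "(T, S) \<in> vclass G (\<lambda>H. - f H)"
    by (simp add: vclass_def) (metis minus_diff_eq)
  then show ?thesis
    by (auto simp: virtual_counts_def)
qed

lemma carrier_burnsideE:
  assumes "A \<in> carrier (burnside_ring G)"
  obtains f where "f \<in> virtual_counts G" "A = vclass G f"
  using assms that by (auto simp: carrier_burnside)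

text \<open>The laws are those of pointwise addition of integer functions, carried over by
  \<open>vclass\<close>. This opens up the theory of \<open>finsum\<close> and of integer
  multiples.\<close>

lemma abelian_group_burnside: "abelian_group (burnside_ring G)"
proof (rule abelian_groupI)
  fix A assume "A \<in> carrier (burnside_ring G)"
  then obtain f where f: "f \<in> virtual_counts G" "A = vclass G f"
    by (rule carrier_burnsideE)
  show "\<exists>B\<in>carrier (burnside_ring G). B \<oplus>\<^bsub>burnside_ring G\<^esub> A = \<zero>\<^bsub>burnside_ring G\<^esub>"
    using uminus_virtual[OF f(1)] f
    by (intro bexI[of _ "vclass G (\<lambda>H. - f H)"]) (auto simp: add_burnside zero_burnside carrier_burnside)
  show "\<zero>\<^bsub>burnside_ring G\<^esub> \<oplus>\<^bsub>burnside_ring G\<^esub> A = A"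
    using add_burnside(1)[OF zero_virtual f(1)] f(2) by (simp add: zero_burnside)
  fix B assume "B \<in> carrier (burnside_ring G)"
  then obtain g where g: "g \<in> virtual_counts G" "B = vclass G g"
    by (rule carrier_burnsideE)
  show "A \<oplus>\<^bsub>burnside_ring G\<^esub> B \<in> carrier (burnside_ring G)"
    using add_burnside[OF f(1) g(1)] f(2) g(2) by (simp add: carrier_burnside)
  show "A \<oplus>\<^bsub>burnside_ring G\<^esub> B = B \<oplus>\<^bsub>burnside_ring G\<^esub> A"
    using add_burnside(1)[OF f(1) g(1)] add_burnside(1)[OF g(1) f(1)] f(2) g(2)
    by (simp add: add.commute)
  fix C assume "C \<in> carrier (burnside_ring G)"
  then obtain h where h: "h \<in> virtual_counts G" "C = vclass G h"
    by (rule carrier_burnsideE)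
  show "A \<oplus>\<^bsub>burnside_ring G\<^esub> B \<oplus>\<^bsub>burnside_ring G\<^esub> C =
      A \<oplus>\<^bsub>burnside_ring G\<^esub> (B \<oplus>\<^bsub>burnside_ring G\<^esub> C)"
    using add_burnside(1)[OF add_burnside(2)[OF f(1) g(1)] h(1)]
      add_burnside(1)[OF f(1) add_burnside(2)[OF g(1) h(1)]]
    by (simp add: f(2) g(2) h(2) add_burnside(1)[OF f(1) g(1)] add_burnside(1)[OF g(1) h(1)] add.assoc)
next
  show "\<zero>\<^bsub>burnside_ring G\<^esub> \<in> carrier (burnside_ring G)"
    using zero_virtual by (simp add: carrier_burnside zero_burnside)
qed

lemma add_pow_burnside:
  fixes k :: int
  assumes f: "f \<in> virtual_counts G"
  shows "(\<lambda>H. k * f H) \<in> virtual_counts G"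
    and "[k] \<cdot>\<^bsub>burnside_ring G\<^esub> vclass G f = vclass G (\<lambda>H. k * f H)"
proof -
  interpret B: abelian_group "burnside_ring G"
    by (rule abelian_group_burnside)
  have nat: "(\<lambda>H. int n * f H) \<in> virtual_counts G \<and>
      [n] \<cdot>\<^bsub>burnside_ring G\<^esub> vclass G f = vclass G (\<lambda>H. int n * f H)" for n :: nat
  proof (induction n)
    case 0
    then show ?case
      by (simp add: zero_burnside zero_virtual)
  next
    case (Suc n)
    then show ?case
      using add_burnside[of "\<lambda>H. int n * f H" f] f by (simp add: algebra_simps)
  qed
  have neg: "\<ominus>\<^bsub>burnside_ring G\<^esub> vclass G g = vclass G (\<lambda>H. - g H)" if "g \<in> virtual_counts G" for g
    using that uminus_virtual[OF that]
    by (intro B.minus_equality) (auto simp: carrier_burnside add_burnside zero_burnside)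
  have "(\<lambda>H. k * f H) \<in> virtual_counts G \<and> [k] \<cdot>\<^bsub>burnside_ring G\<^esub> vclass G f = vclass G (\<lambda>H. k * f H)"
  proof (cases "k \<ge> 0")
    case True
    then show ?thesis
      using nat[of "nat k"] by (simp add: add_pow_int_ge)
  next
    case False
    then show ?thesis
      using nat[of "nat (- k)"] neg[of "\<lambda>H. int (nat (- k)) * f H"]
        uminus_virtual[of "\<lambda>H. int (nat (- k)) * f H"]
      by (simp add: add_pow_int_lt)
  qed
  then show "(\<lambda>H. k * f H) \<in> virtual_counts G"
    "[k] \<cdot>\<^bsub>burnside_ring G\<^esub> vclass G f = vclass G (\<lambda>H. k * f H)"
    by auto
qed

lemma finsum_burnside:
  assumes "finite I" "\<And>i. i \<in> I \<Longrightarrow> F i \<in> virtual_counts G"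
  shows "(\<lambda>H. \<Sum>i\<in>I. F i H) \<in> virtual_counts G \<and>
    finsum (burnside_ring G) (\<lambda>i. vclass G (F i)) I = vclass G (\<lambda>H. \<Sum>i\<in>I. F i H)"
proof -
  interpret B: abelian_group "burnside_ring G"
    by (rule abelian_group_burnside)
  show ?thesis
    using assms
  proof (induction I rule: finite_induct)
    case empty
    then show ?case
      by (simp add: zero_burnside zero_virtual)
  next
    case (insert i I)
    then have "finsum (burnside_ring G) (\<lambda>i. vclass G (F i)) (insert i I) =
        vclass G (F i) \<oplus>\<^bsub>burnside_ring G\<^esub> finsum (burnside_ring G) (\<lambda>i. vclass G (F i)) I"
      by (intro B.finsum_insert) (auto simp: carrier_burnside)
    then show ?case
      using insert add_burnside[of "F i" "\<lambda>H. \<Sum>i\<in>I. F i H"] by simp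
  qed
qed

section \<open>Marks of virtual G-sets and of units\<close>

text \<open>The difference of fixed point numbers depends on \<open>f\<close> only, so the image
  from which \<open>the_elem\<close> picks is a singleton.\<close>

lemma mark_vclass:
  assumes "f \<in> virtual_counts G" "finite (carrier G)" "K \<subseteq> carrier G"
  shows "mark K (vclass G f) = (\<Sum>H | subgroup H G \<and> K \<subseteq> H. f H)"
proof -
  have "int (card (fixed_points X K)) - int (card (fixed_points Y K)) =
      (\<Sum>H | subgroup H G \<and> K \<subseteq> H. f H)" if "(X, Y) \<in> vclass G f" for X Y
    using that assms(2,3) by (auto simp: vclass_def card_fixed_points simp flip: sum_subtractf)
  then have "(\<lambda>(X, Y). int (card (fixed_points X K)) - int (card (fixed_points Y K))) ` vclass G f =
      (\<lambda>_. \<Sum>H | subgroup H G \<and> K \<subseteq> H. f H) ` vclass G f"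
    by (intro image_cong) auto
  also have "\<dots> = {\<Sum>H | subgroup H G \<and> K \<subseteq> H. f H}"
    using assms(1) by (auto simp: virtual_counts_def)
  finally show ?thesis
    by (simp add: mark_def)
qed

text \<open>Marks are multiplicative and the mark of the identity is \<open>1\<close>, so the mark
  of \<open>u\<close> divides \<open>1\<close> in the integers.\<close>

lemma mark_unit:
  assumes u: "u \<in> Units (burnside_ring G)" and fin: "finite (carrier G)" and K: "K \<subseteq> carrier G"
  shows "mark K u = 1 \<or> mark K u = -1"
proof -
  obtain v where v: "v \<in> carrier (burnside_ring G)" "u \<in> carrier (burnside_ring G)"
    "u \<otimes>\<^bsub>burnside_ring G\<^esub> v = \<one>\<^bsub>burnside_ring G\<^esub>"
    using u by (auto simp: Units_def)
  let ?fx = "\<lambda>X. int (card (fixed_points X K))"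
  have one: "\<one>\<^bsub>burnside_ring G\<^esub> = vclass G (\<lambda>H. stab_count G gset_point H - stab_count G gset_empty H)"
    using gdiff_eq_vclass[OF fin_gset_point fin_gset_empty]
    by (simp add: burnside_ring_def gclass_def)
  \<comment> \<open>This pair represents the identity, so it lies in one member of the union that
    defines the product; that member yields concrete representatives of \<open>u\<close> and
    \<open>v\<close>.\<close>
  then have "(gset_point, gset_empty) \<in> u \<otimes>\<^bsub>burnside_ring G\<^esub> v"
    by (auto simp: v(3) vclass_def fin_gset_point fin_gset_empty)
  then obtain X Y X' Y' where XY: "(X, Y) \<in> u" "(X', Y') \<in> v"
    and mem: "(gset_point, gset_empty) \<in> gdiff G (gset_sum (gset_prod X X') (gset_prod Y Y'))
      (gset_sum (gset_prod X Y') (gset_prod Y X'))"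
    by (auto simp: burnside_ring_def)
  obtain f where f: "u = vclass G f" "f \<in> virtual_counts G"
    using v(2) by (auto simp: carrier_burnside)
  obtain g where g: "v = vclass G g"
    using v(1) by (auto simp: carrier_burnside)
  have f_eq: "f = (\<lambda>H. stab_count G X H - stab_count G Y H)"
    using XY(1) f(1) by (auto simp: vclass_def)
  have finXY: "fin_gset G X" "fin_gset G Y" "fin_gset G X'" "fin_gset G Y'"
    using XY f g by (auto simp: vclass_def)
  have "stab_count G gset_point H =
     stab_count G (gset_prod X X') H + stab_count G (gset_prod Y Y') H -
     (stab_count G (gset_prod X Y') H + stab_count G (gset_prod Y X') H)" for H
    using mem finXY
    by (subst (asm) gdiff_eq_vclass)
      (auto simp: vclass_def fin_gset_sum fin_gset_prod stab_count_sum stab_count_empty)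
  \<comment> \<open>Summing over all \<open>H\<close> above \<open>K\<close> turns counts into
    numbers of fixed points.\<close>
  then have "(\<Sum>H | subgroup H G \<and> K \<subseteq> H. stab_count G gset_point H) =
     ?fx (gset_prod X X') + ?fx (gset_prod Y Y') - (?fx (gset_prod X Y') + ?fx (gset_prod Y X'))"
    using finXY fin K by (simp add: card_fixed_points fin_gset_prod sum.distrib sum_subtractf)
  \<comment> \<open>The fixed points of the four products combine to a product of two
    differences.\<close>
  then have "(?fx X - ?fx Y) * (?fx X' - ?fx Y') = 1"
    using card_fixed_points[OF fin_gset_point fin K]
    by (simp add: card_fixed_points_prod card_fixed_points_point algebra_simps)
  moreover have "?fx X - ?fx Y = mark K u"
    using finXY f fin K
    by (simp add: mark_vclass f_eq card_fixed_points sum_subtractf)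
  ultimately show ?thesis
    using zmult_eq_1_iff by auto
qed

end

section \<open>The basis of transitive \<open>G\<close>-sets\<close>

context group
begin

lemma mult_inv_cancel:
  assumes "g \<in> carrier G" "x \<in> carrier G"
  shows "g \<otimes> (inv g \<otimes> x) = x" "inv g \<otimes> (g \<otimes> x) = x"
  using assms by (simp_all flip: m_assoc)

text \<open>Reduces equations between conjugates to elementwise calculations, which
  \<open>m_assoc\<close> and \<open>mult_inv_cancel\<close> normalise.\<close>

lemma conjugate_iff:
  assumes "H \<subseteq> carrier G" "g \<in> carrier G"
  shows "x \<in> g <# H #> inv g \<longleftrightarrow> x \<in> carrier G \<and> inv g \<otimes> x \<otimes> g \<in> H"
proof
  assume "x \<in> g <# H #> inv g"
  then obtain h where h: "h \<in> H" "x = g \<otimes> h \<otimes> inv g"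
    by (auto simp: l_coset_def r_coset_def)
  have hc: "h \<in> carrier G"
    using h assms by blast
  have "inv g \<otimes> x \<otimes> g = h"
    using hc assms(2) by (simp add: h(2) mult_inv_cancel m_assoc)
  then show "x \<in> carrier G \<and> inv g \<otimes> x \<otimes> g \<in> H"
    using h hc assms(2) by simp
next
  assume *: "x \<in> carrier G \<and> inv g \<otimes> x \<otimes> g \<in> H"
  then have "x = g \<otimes> (inv g \<otimes> x \<otimes> g) \<otimes> inv g"
    using assms(2) by (simp add: m_assoc mult_inv_cancel)
  then show "x \<in> g <# H #> inv g"
    using * by (auto simp: l_coset_def r_coset_def)
qed

lemma conjugate_conjugate:
  assumes "H \<subseteq> carrier G" "g \<in> carrier G" "a \<in> carrier G"
  shows "a <# (g <# H #> inv g) #> inv a = (a \<otimes> g) <# H #> inv (a \<otimes> g)"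
proof (rule Set.set_eqI)
  fix x
  have sub: "g <# H #> inv g \<subseteq> carrier G"
    using conjugate_iff[OF assms(1,2)] by blast
  have "inv g \<otimes> (inv a \<otimes> x \<otimes> a) \<otimes> g = inv (a \<otimes> g) \<otimes> x \<otimes> (a \<otimes> g)" if "x \<in> carrier G"
    using that assms(2,3) by (simp add: m_assoc inv_mult_group)
  then show "x \<in> a <# (g <# H #> inv g) #> inv a \<longleftrightarrow> x \<in> (a \<otimes> g) <# H #> inv (a \<otimes> g)"
    using assms by (auto simp: conjugate_iff[OF sub] conjugate_iff)
qed

lemma conjugate_one:
  assumes "H \<subseteq> carrier G"
  shows "\<one> <# H #> inv \<one> = H"
  using lcos_mult_one[OF assms] coset_mult_one[OF assms] by simp

lemma subgroup_conjugate:
  assumes "subgroup H G" "g \<in> carrier G"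
  shows "subgroup (g <# H #> inv g) G"
proof -
  note iff = conjugate_iff[OF subgroup.subset[OF assms(1)] assms(2)]
  show ?thesis
  proof (rule subgroup.intro)
    show "g <# H #> inv g \<subseteq> carrier G"
      using iff by blast
    show "\<one> \<in> g <# H #> inv g"
      using assms by (simp add: iff subgroup.one_closed)
    fix x assume x: "x \<in> g <# H #> inv g"
    have "inv (inv g \<otimes> x \<otimes> g) = inv g \<otimes> inv x \<otimes> g"
      using x assms(2) by (simp add: iff inv_mult_group m_assoc)
    then show "inv x \<in> g <# H #> inv g"
      using x subgroup.m_inv_closed[OF assms(1), of "inv g \<otimes> x \<otimes> g"] by (auto simp: iff)
    fix y assume y: "y \<in> g <# H #> inv g"
    have "(inv g \<otimes> x \<otimes> g) \<otimes> (inv g \<otimes> y \<otimes> g) = inv g \<otimes> (x \<otimes> y) \<otimes> g"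
      using x y assms(2) by (simp add: iff m_assoc mult_inv_cancel)
    then show "x \<otimes> y \<in> g <# H #> inv g"
      using x y subgroup.m_closed[OF assms(1), of "inv g \<otimes> x \<otimes> g" "inv g \<otimes> y \<otimes> g"]
      by (auto simp: iff)
  qed
qed

lemma conj_class_self:
  assumes "subgroup H G"
  shows "H \<in> conj_class G H"
  using conjugate_one[OF subgroup.subset[OF assms]] unfolding conj_class_def
  by (intro image_eqI[of _ _ \<one>]) auto

lemma conj_class_eqI:
  assumes "subgroup H G" "K \<in> conj_class G H"
  shows "subgroup K G" "conj_class G K = conj_class G H"
proof -
  obtain g where g: "g \<in> carrier G" "K = g <# H #> inv g"
    using assms(2) by (auto simp: conj_class_def)
  show "subgroup K G"
    using g subgroup_conjugate assms(1) by simp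
  note cc = conjugate_conjugate[OF subgroup.subset[OF assms(1)]]
  show "conj_class G K = conj_class G H"
  proof (intro equalityI subsetI)
    fix L assume "L \<in> conj_class G K"
    then obtain a where "a \<in> carrier G" "L = a <# K #> inv a"
      by (auto simp: conj_class_def)
    then show "L \<in> conj_class G H"
      using g cc by (auto simp: conj_class_def)
  next
    fix L assume "L \<in> conj_class G H"
    then obtain a where a: "a \<in> carrier G" "L = a <# H #> inv a"
      by (auto simp: conj_class_def)
    \<comment> \<open>\<open>H\<close> is the conjugate of \<open>K\<close> by \<open>inv g\<close>,
      so conjugating \<open>H\<close> by \<open>a\<close> is conjugating \<open>K\<close> by
      \<open>a \<otimes> inv g\<close>.\<close>
    then have "L = (a \<otimes> inv g) <# K #> inv (a \<otimes> inv g)"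
      using g cc[of g "a \<otimes> inv g"] by (simp add: m_assoc)
    then show "L \<in> conj_class G K"
      using a g by (auto simp: conj_class_def)
  qed
qed

text \<open>A class contains the subgroup it comes from, so there is something to choose, and every
  member has the same class.\<close>

lemma class_rep:
  assumes "C \<in> subgroup_classes G"
  shows "subgroup (class_rep C) G" "conj_class G (class_rep C) = C"
proof -
  obtain H where H: "subgroup H G" "C = conj_class G H"
    using assms by (auto simp: subgroup_classes_def)
  then have "class_rep C \<in> C"
    using conj_class_self unfolding class_rep_def by (metis someI)
  then show "subgroup (class_rep C) G" "conj_class G (class_rep C) = C"
    using conj_class_eqI[OF H(1), of "class_rep C"] H(2) by auto
qed

lemma finite_subgroup_classes:
  assumes "finite (carrier G)"
  shows "finite (subgroup_classes G)"
proof -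
  have "{H. subgroup H G} \<subseteq> Pow (carrier G)"
    by (auto dest: subgroup.subset)
  then have "finite {H. subgroup H G}"
    using assms finite_subset by blast
  then show ?thesis
    by (simp add: subgroup_classes_def)
qed

section \<open>Stabilizers and point counts of coset spaces\<close>

text \<open>An element \<open>h\<close> fixes the translate by \<open>g\<close> exactly if
  \<open>inv g \<otimes> h \<otimes> g\<close> fixes \<open>x\<close>.\<close>

lemma stabilizer_translate:
  assumes X: "fin_gset G X" and g: "g \<in> carrier G" and x: "x \<in> fst X"
  shows "stabilizer G (snd X) (snd X g x) = g <# stabilizer G (snd X) x #> inv g"
proof (rule Set.set_eqI)
  fix h
  have sub: "stabilizer G (snd X) x \<subseteq> carrier G"
    by (auto simp: stabilizer_def)
  have "snd X h (snd X g x) = snd X g x \<longleftrightarrow> snd X (inv g \<otimes> h \<otimes> g) x = x" if h: "h \<in> carrier G"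
  proof -
    have "snd X (inv g \<otimes> h \<otimes> g) x = snd X (inv g) (snd X h (snd X g x))"
      using fin_gsetD(5)[OF X _ _ x, of "inv g" "h \<otimes> g"] fin_gsetD(5)[OF X h g x] h g
      by (simp add: m_assoc)
    then show ?thesis
      using fin_gset_inv_cancel[OF X g] fin_gsetD(3)[OF X] x g h by metis
  qed
  then show "h \<in> stabilizer G (snd X) (snd X g x) \<longleftrightarrow> h \<in> g <# stabilizer G (snd X) x #> inv g"
    using g unfolding conjugate_iff[OF sub g] by (auto simp: stabilizer_def)
qed

text \<open>Presents the coset space as the orbit of the coset \<open>H\<close>, whose stabilizer is
  \<open>H\<close> itself, so that the comparison of orbits applies to it.\<close>

lemma gset_coset_base_point:
  assumes H: "subgroup H G"
  shows "H \<in> fst (gset_coset G H)"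
    and "\<And>g. g \<in> carrier G \<Longrightarrow> snd (gset_coset G H) g H = g <# H"
    and "fst (gset_coset G H) = orbit G (snd (gset_coset G H)) H"
    and "stabilizer G (snd (gset_coset G H)) H = H"
proof -
  have HG: "H \<subseteq> carrier G"
    using subgroup.subset[OF H] .
  have one: "\<one> <# H = H"
    using lcos_mult_one[OF HG] .
  then show mem: "H \<in> fst (gset_coset G H)"
    by (auto simp: gset_coset_def LCOSETS_def intro!: bexI[of _ \<one>])
  then show act: "snd (gset_coset G H) g H = g <# H" if "g \<in> carrier G" for g
    by (simp add: gset_coset_def)
  show "fst (gset_coset G H) = orbit G (snd (gset_coset G H)) H"
    using act by (auto simp: orbit_def gset_coset_def LCOSETS_def)
  have "g <# H = H \<longleftrightarrow> g \<in> H" if "g \<in> carrier G" for g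
    using lcos_self[OF that H] coset_join3[OF that H] by auto
  then show "stabilizer G (snd (gset_coset G H)) H = H"
    using act HG by (auto simp: stabilizer_def)
qed

lemma fin_gset_coset:
  assumes H: "subgroup H G" and fin: "finite (carrier G)"
  shows "fin_gset G (gset_coset G H)"
proof (rule fin_gsetI)
  have HG: "H \<subseteq> carrier G"
    using subgroup.subset[OF H] .
  show "finite (fst (gset_coset G H))"
    using fin by (simp add: gset_coset_def LCOSETS_def)
  show "snd (gset_coset G H) g \<in> extensional (fst (gset_coset G H))" for g
    by (simp add: gset_coset_def)
  fix D assume D: "D \<in> fst (gset_coset G H)"
  then obtain a where a: "a \<in> carrier G" "D = a <# H"
    by (auto simp: gset_coset_def LCOSETS_def)
  then have act: "snd (gset_coset G H) k D = (k \<otimes> a) <# H" if "k \<in> carrier G" for k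
    using D that lcos_m_assoc[OF HG] by (simp add: gset_coset_def)
  have mem: "b <# H \<in> fst (gset_coset G H)" if "b \<in> carrier G" for b
    using that by (auto simp: gset_coset_def LCOSETS_def)
  show "snd (gset_coset G H) \<one> D = D"
    using act a by simp
  fix g assume g: "g \<in> carrier G"
  show "snd (gset_coset G H) g D \<in> fst (gset_coset G H)"
    using act a g mem by simp
  fix h assume h: "h \<in> carrier G"
  have "snd (gset_coset G H) g ((h \<otimes> a) <# H) = (g \<otimes> (h \<otimes> a)) <# H"
    using mem a(1) g h lcos_m_assoc[OF HG] by (simp add: gset_coset_def)
  then show "snd (gset_coset G H) (g \<otimes> h) D = snd (gset_coset G H) g (snd (gset_coset G H) h D)"
    using act g h a by (simp add: m_assoc)
qed

lemma stabilizer_coset: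
  assumes H: "subgroup H G" and fin: "finite (carrier G)" and D: "D \<in> fst (gset_coset G H)"
  shows "\<exists>g\<in>carrier G. stabilizer G (snd (gset_coset G H)) D = g <# H #> inv g"
proof -
  obtain g where g: "g \<in> carrier G" "D = snd (gset_coset G H) g H"
    using D gset_coset_base_point(3)[OF H] by (auto simp: orbit_def)
  then show ?thesis
    using stabilizer_translate[OF fin_gset_coset[OF H fin] g(1) gset_coset_base_point(1)[OF H]]
      gset_coset_base_point(4)[OF H] by auto
qed

text \<open>Stabilizers in the coset space are conjugates of \<open>H\<close>, so its counts live on
  a single conjugacy class.\<close>

lemma stab_count_coset:
  assumes H: "subgroup H G" and fin: "finite (carrier G)"
  shows "stab_count G (gset_coset G H) H > 0"
    and "K \<notin> conj_class G H \<Longrightarrow> stab_count G (gset_coset G H) K = 0"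
proof -
  have "finite (fst (gset_coset G H))"
    using fin_gsetD(1)[OF fin_gset_coset[OF assms]] .
  then show "stab_count G (gset_coset G H) H > 0"
    using gset_coset_base_point(1,4)[OF H] by (auto simp: stab_count_def card_gt_0_iff)
  assume "K \<notin> conj_class G H"
  then have "{D \<in> fst (gset_coset G H). stabilizer G (snd (gset_coset G H)) D = K} = {}"
    using stabilizer_coset[OF assms] by (auto simp: conj_class_def)
  then show "stab_count G (gset_coset G H) K = 0"
    unfolding stab_count_def by (simp only: card.empty)
qed

definition coset_count :: "'a set set \<Rightarrow> 'a set \<Rightarrow> int" where
  "coset_count C = stab_count G (gset_coset G (class_rep C))"

text \<open>Where the table of marks is triangular, the matrix of counts at class representatives is
  even diagonal, with positive diagonal.\<close>

lemma coset_count_class_rep: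
  assumes "C \<in> subgroup_classes G" "D \<in> subgroup_classes G" "finite (carrier G)"
  shows "coset_count C (class_rep C) > 0"
    and "C \<noteq> D \<Longrightarrow> coset_count C (class_rep D) = 0"
proof -
  note C = class_rep[OF assms(1)] and D = class_rep[OF assms(2)]
  show "coset_count C (class_rep C) > 0"
    unfolding coset_count_def using stab_count_coset(1)[OF C(1) assms(3)] .
  assume "C \<noteq> D"
  then have "class_rep D \<notin> conj_class G (class_rep C)"
    using conj_class_eqI(2)[OF C(1)] C(2) D(2) by metis
  then show "coset_count C (class_rep D) = 0"
    unfolding coset_count_def using stab_count_coset(2)[OF C(1) assms(3)] by blast
qed

section \<open>Expansion in the basis of transitive G-sets\<close>

text \<open>Induction on the number of points: one orbit is split off and recognised as a coset
  space, and the coefficient of its class goes up by one.\<close>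

lemma ex_basis_coeff_gset:
  assumes fin: "finite (carrier G)" and "fin_gset G X"
  shows "\<exists>a. \<forall>K. stab_count G X K = (\<Sum>C\<in>subgroup_classes G. a C * coset_count C K)"
  using assms(2)
proof (induction "card (fst X)" arbitrary: X rule: less_induct)
  case less
  note X = less.prems
  show ?case
  proof (cases "fst X = {}")
    case True
    then show ?thesis
      by (intro exI[of _ "\<lambda>_. 0"]) (simp add: stab_count_def)
  next
    case False
    then obtain z where z: "z \<in> fst X"
      by blast
    \<comment> \<open>Moving \<open>z\<close> inside its orbit gives a point \<open>x\<close> whose
      stabilizer is exactly the chosen representative of \<open>C\<close>.\<close>
    define C where "C = conj_class G (stabilizer G (snd X) z)"
    have C: "C \<in> subgroup_classes G"
      using fin_gsetD(6)[OF X z] by (auto simp: C_def subgroup_classes_def)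
    have "class_rep C \<in> C"
      using conj_class_self class_rep[OF C] by metis
    then obtain g where g: "g \<in> carrier G" "class_rep C = stabilizer G (snd X) (snd X g z)"
      using stabilizer_translate[OF X _ z] by (auto simp: C_def conj_class_def)
    define x where "x = snd X g z"
    have x: "x \<in> fst X" "stabilizer G (snd X) x = class_rep C"
      using g z fin_gsetD(3)[OF X] by (auto simp: x_def)
    let ?A = "orbit G (snd X) x" and ?Y = "gset_coset G (class_rep C)"
    note o = orbit_invariant[OF X x(1)] and Y = gset_coset_base_point[OF class_rep(1)[OF C]]
    have "gset_iso G (gset_restrict X ?A) (gset_restrict ?Y (fst ?Y))"
      unfolding Y(3)
      by (rule gset_iso_orbit[OF X fin_gset_coset[OF class_rep(1)[OF C] fin] x(1) Y(1)])
        (simp add: x(2) Y(4))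
    \<comment> \<open>The action maps of \<open>gset_coset\<close> are already restricted to the
      coset space.\<close>
    moreover have "gset_restrict ?Y (fst ?Y) = ?Y"
      by (simp add: gset_restrict_def gset_coset_def)
    ultimately have "stab_count G (gset_restrict X ?A) K = coset_count C K" for K
      unfolding coset_count_def
      using stab_count_iso[of "gset_restrict X ?A" ?Y] fin_gset_restrict[OF X o(2,3)] by simp
    moreover have "card (fst (gset_restrict X (fst X - ?A))) < card (fst X)"
      using x o(1) fin_gsetD(1)[OF X] by (auto simp: gset_restrict_def intro!: psubset_card_mono)
    then obtain a where "\<And>K. stab_count G (gset_restrict X (fst X - ?A)) K =
        (\<Sum>C\<in>subgroup_classes G. a C * coset_count C K)"
      using less.hyps fin_gset_restrict[OF X _ o(4)] by (metis Diff_subset)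
    ultimately have "stab_count G X K = coset_count C K +
        (\<Sum>D\<in>subgroup_classes G. a D * coset_count D K)" for K
      using stab_count_restrict[OF X o(2)] by simp
    also have "coset_count C K + (\<Sum>D\<in>subgroup_classes G. a D * coset_count D K) =
        (\<Sum>D\<in>subgroup_classes G. (a(C := a C + 1)) D * coset_count D K)" for K
      using C finite_subgroup_classes[OF fin]
      by (simp add: sum.remove[of _ C] algebra_simps)
    finally show ?thesis
      by blast
  qed
qed

lemma ex_basis_coeff:
  assumes fin: "finite (carrier G)" and f: "f \<in> virtual_counts G"
  shows "\<exists>a. f = (\<lambda>K. \<Sum>C\<in>subgroup_classes G. a C * coset_count C K)"
proof -
  obtain S T where "(S, T) \<in> vclass G f" and ST: "fin_gset G S" "fin_gset G T"
    "f = (\<lambda>H. stab_count G S H - stab_count G T H)"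
    using f by (rule virtual_countsE)
  obtain a where a: "\<forall>K. stab_count G S K = (\<Sum>C\<in>subgroup_classes G. a C * coset_count C K)"
    using ex_basis_coeff_gset[OF fin ST(1)] ..
  obtain b where b: "\<forall>K. stab_count G T K = (\<Sum>C\<in>subgroup_classes G. b C * coset_count C K)"
    using ex_basis_coeff_gset[OF fin ST(2)] ..
  have "f = (\<lambda>K. \<Sum>C\<in>subgroup_classes G. (a C - b C) * coset_count C K)"
    using a b by (simp add: ST(3) sum_subtractf left_diff_distrib)
  then show ?thesis
    by (rule exI[of _ "\<lambda>C. a C - b C"])
qed

text \<open>Translates the expansion in the definition of \<open>burnside_coeff\<close> into an
  identity of integer functions.\<close>

lemma basis_expansion:
  assumes fin: "finite (carrier G)"
  shows "finsum (burnside_ring G)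
      (\<lambda>C. [a C] \<cdot>\<^bsub>burnside_ring G\<^esub> gclass G (gset_coset G (class_rep C))) (subgroup_classes G) =
    vclass G (\<lambda>K. \<Sum>C\<in>subgroup_classes G. a C * coset_count C K)" (is "?L = ?R")
proof -
  interpret B: abelian_group "burnside_ring G"
    by (rule abelian_group_burnside)
  have *: "(\<lambda>K. a C * coset_count C K) \<in> virtual_counts G \<and>
    [a C] \<cdot>\<^bsub>burnside_ring G\<^esub> gclass G (gset_coset G (class_rep C)) =
      vclass G (\<lambda>K. a C * coset_count C K)" if "C \<in> subgroup_classes G" for C
  proof -
    note c = fin_gset_coset[OF class_rep(1)[OF that] fin]
    have "coset_count C \<in> virtual_counts G"
      using stab_count_diff_virtual[OF c fin_gset_empty]
      by (simp add: stab_count_empty coset_count_def)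
    moreover have "gclass G (gset_coset G (class_rep C)) = vclass G (coset_count C)"
      using gdiff_eq_vclass[OF c fin_gset_empty]
      by (simp add: gclass_def stab_count_empty coset_count_def)
    ultimately show ?thesis
      using add_pow_burnside by simp
  qed
  then have "?L = finsum (burnside_ring G) (\<lambda>C. vclass G (\<lambda>K. a C * coset_count C K)) (subgroup_classes G)"
    by (intro B.finsum_cong') (auto simp: carrier_burnside)
  also have "\<dots> = ?R"
    using finsum_burnside[OF finite_subgroup_classes[OF fin], of "\<lambda>C K. a C * coset_count C K"] *
    by simp
  finally show ?thesis .
qed

text \<open>Evaluation at \<open>class_rep D\<close> leaves only the term of \<open>D\<close>, whose
  factor is positive.\<close>

lemma coset_count_independent:
  assumes fin: "finite (carrier G)"
    and eq: "(\<lambda>K. \<Sum>C\<in>subgroup_classes G. a C * coset_count C K) =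
      (\<lambda>K. \<Sum>C\<in>subgroup_classes G. b C * coset_count C K)"
    and D: "D \<in> subgroup_classes G"
  shows "a D = b D"
proof -
  have "(\<Sum>C\<in>subgroup_classes G. c C * coset_count C (class_rep D)) =
      c D * coset_count D (class_rep D)" for c
  proof -
    have "(\<Sum>C\<in>subgroup_classes G. c C * coset_count C (class_rep D)) =
        (\<Sum>C\<in>subgroup_classes G. if C = D then c D * coset_count D (class_rep D) else 0)"
      using coset_count_class_rep(2)[OF _ D fin] by (intro sum.cong) auto
    then show ?thesis
      using finite_subgroup_classes[OF fin] D by simp
  qed
  then have "a D * coset_count D (class_rep D) = b D * coset_count D (class_rep D)"
    using fun_cong[OF eq, of "class_rep D"] by metis
  then show ?thesis
    using coset_count_class_rep(1)[OF D D fin] by simp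
qed

text \<open>Existence and uniqueness of the expansion give the definite description in
  \<open>burnside_coeff\<close> its meaning.\<close>

lemma burnside_coeff_expansion:
  assumes fin: "finite (carrier G)" and f: "f \<in> virtual_counts G"
  shows "f = (\<lambda>K. \<Sum>C\<in>subgroup_classes G. burnside_coeff G (vclass G f) C * coset_count C K)"
proof -
  let ?e = "\<lambda>a K. \<Sum>C\<in>subgroup_classes G. a C * coset_count C K"
  let ?P = "\<lambda>a. a \<in> subgroup_classes G \<rightarrow>\<^sub>E UNIV \<and> vclass G f = vclass G (?e a)"
  obtain a where a: "f = ?e a"
    using ex_basis_coeff[OF assms] by blast
  \<comment> \<open>The description asks for a family that is extensional on
    \<open>subgroup_classes G\<close>, hence the restriction.\<close>
  define a' where "a' = restrict a (subgroup_classes G)"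
  have a': "f = ?e a'"
    unfolding a a'_def by simp
  have "?P a'"
    using a' by (simp add: a'_def)
  moreover have "b = a'" if "?P b" for b
  proof (rule extensionalityI[of _ "subgroup_classes G"])
    show "b \<in> extensional (subgroup_classes G)" "a' \<in> extensional (subgroup_classes G)"
      using that \<open>?P a'\<close> by (auto simp: PiE_def)
    have "f = ?e b"
      using that f vclass_inject by blast
    then show "b D = a' D" if "D \<in> subgroup_classes G" for D
      using coset_count_independent[OF fin _ that, of b a'] a' by simp
  qed
  ultimately have "burnside_coeff G (vclass G f) = a'"
    unfolding burnside_coeff_def basis_expansion[OF fin] by (rule the_equality)
  then show ?thesis
    using a' by simp
qed

section \<open>Cores and the sum of coefficients above a normal subgroup\<close>

lemma core_normal:
  assumes "subgroup H G"
  shows "core G H \<lhd> G"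
proof -
  have H: "H \<subseteq> carrier G"
    using subgroup.subset[OF assms] .
  have sub: "subgroup (core G H) G"
    unfolding core_def using subgroup_conjugate[OF assms] by (intro subgroups_Inter) auto
  have "a \<otimes> x \<otimes> inv a \<in> core G H" if a: "a \<in> carrier G" and x: "x \<in> core G H" for a x
  proof -
    have xc: "x \<in> carrier G"
      using x subgroup.subset[OF sub] by blast
    have "a \<otimes> x \<otimes> inv a \<in> g <# H #> inv g" if g: "g \<in> carrier G" for g
    proof -
      \<comment> \<open>\<open>x\<close> lies in every conjugate of \<open>H\<close>; conjugation by
        \<open>a\<close> turns the one by \<open>inv a \<otimes> g\<close> into the one by
        \<open>g\<close>.\<close>
      have "x \<in> (inv a \<otimes> g) <# H #> inv (inv a \<otimes> g)"
        using x a g by (auto simp: core_def)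
      then have "inv (inv a \<otimes> g) \<otimes> x \<otimes> (inv a \<otimes> g) \<in> H"
        using conjugate_iff[OF H] a g by simp
      moreover have "inv (inv a \<otimes> g) \<otimes> x \<otimes> (inv a \<otimes> g) = inv g \<otimes> (a \<otimes> x \<otimes> inv a) \<otimes> g"
        using xc a g by (simp add: inv_mult_group m_assoc)
      ultimately show ?thesis
        using conjugate_iff[OF H g] xc a by simp
    qed
    then show ?thesis
      by (simp add: core_def)
  qed
  with sub show ?thesis
    by (simp add: normal_inv_iff)
qed

text \<open>Conjugation maps \<open>N\<close> into itself, so inclusion in \<open>H\<close> passes
  to every conjugate and back.\<close>

lemma normal_subset_conjugate:
  assumes N: "N \<lhd> G" and H: "H \<subseteq> carrier G" and g: "g \<in> carrier G"
  shows "N \<subseteq> g <# H #> inv g \<longleftrightarrow> N \<subseteq> H"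
proof -
  have NG: "N \<subseteq> carrier G"
    using N by (simp add: normal_imp_subgroup subgroup.subset)
  have c: "inv k \<otimes> x \<otimes> k \<in> N" if "x \<in> N" "k \<in> carrier G" for x k
    using normal.inv_op_closed1[OF N that(2,1)] .
  show ?thesis
  proof
    assume L: "N \<subseteq> g <# H #> inv g"
    show "N \<subseteq> H"
    proof
      fix x assume x: "x \<in> N"
      then have "inv (inv g) \<otimes> x \<otimes> inv g \<in> g <# H #> inv g"
        using c[OF x, of "inv g"] L g by auto
      then have "inv g \<otimes> (g \<otimes> x \<otimes> inv g) \<otimes> g \<in> H"
        using conjugate_iff[OF H g] g by simp
      moreover have "inv g \<otimes> (g \<otimes> x \<otimes> inv g) \<otimes> g = x"
        using x NG g by (simp add: m_assoc mult_inv_cancel subset_iff)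
      ultimately show "x \<in> H"
        by simp
    qed
  next
    assume "N \<subseteq> H"
    then show "N \<subseteq> g <# H #> inv g"
      using c g NG conjugate_iff[OF H g] by blast
  qed
qed

lemma normal_subset_core:
  assumes "N \<lhd> G" "subgroup H G"
  shows "N \<subseteq> core G H \<longleftrightarrow> N \<subseteq> H"
proof -
  have "N \<subseteq> core G H \<longleftrightarrow> (\<forall>g\<in>carrier G. N \<subseteq> g <# H #> inv g)"
    by (auto simp: core_def)
  also have "\<dots> \<longleftrightarrow> N \<subseteq> H"
    using normal_subset_conjugate[OF assms(1) subgroup.subset[OF assms(2)]] by blast
  finally show ?thesis .
qed

text \<open>Each class whose representative contains \<open>N\<close> is counted at exactly one
  \<open>M\<close>, the core of the representative, which is normal and contains
  \<open>N\<close>.\<close>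

lemma core_sum_eq:
  assumes fin: "finite (carrier G)" and N: "N \<lhd> G"
  shows "core_sum G N u =
    (\<Sum>C\<in>{C \<in> subgroup_classes G. N \<subseteq> class_rep C}. burnside_coeff G u C)"
proof -
  let ?T = "{M. M \<lhd> G \<and> N \<subseteq> M}" and ?S = "{C \<in> subgroup_classes G. N \<subseteq> class_rep C}"
  have core: "N \<subseteq> core G (class_rep C) \<longleftrightarrow> N \<subseteq> class_rep C" "core G (class_rep C) \<lhd> G"
    if "C \<in> subgroup_classes G" for C
    using normal_subset_core[OF N] core_normal class_rep(1)[OF that] by auto
  have "?T \<subseteq> Pow (carrier G)"
    by (auto dest!: normal_imp_subgroup subgroup.subset)
  then have "finite ?T"
    using fin finite_subset by blast
  have "core_sum G N u =
      (\<Sum>M\<in>?T. \<Sum>C\<in>{C \<in> ?S. core G (class_rep C) = M}. burnside_coeff G u C)"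
    unfolding core_sum_def core_coeff_def using core by (intro sum.cong) auto
  also have "\<dots> = (\<Sum>C\<in>?S. burnside_coeff G u C)"
    using core finite_subgroup_classes[OF fin] \<open>finite ?T\<close> by (intro sum.group) auto
  finally show ?thesis .
qed

end

section \<open>Orbit counting and the main theorem\<close>

context group
begin

lemma card_conjugate:
  assumes "H \<subseteq> carrier G" "g \<in> carrier G"
  shows "card (g <# H #> inv g) = card H"
proof -
  have "g <# H #> inv g = (\<lambda>h. g \<otimes> h \<otimes> inv g) ` H"
    by (auto simp: l_coset_def r_coset_def)
  moreover have "inj_on (\<lambda>h. g \<otimes> h \<otimes> inv g) H"
    using assms by (intro inj_on_inverseI[where g = "\<lambda>h. inv g \<otimes> h \<otimes> g"])
      (auto simp: m_assoc mult_inv_cancel)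
  ultimately show ?thesis
    by (simp add: card_image)
qed

text \<open>All stabilizers in the coset space are conjugate to \<open>class_rep C\<close>: they
  have its order, and they contain \<open>N\<close> exactly if it does. The sum is index times
  order, or empty.\<close>

lemma sum_card_coset_count:
  assumes fin: "finite (carrier G)" and N: "N \<lhd> G" and C: "C \<in> subgroup_classes G"
  shows "(\<Sum>H | subgroup H G \<and> N \<subseteq> H. int (card H) * coset_count C H) =
    (if N \<subseteq> class_rep C then int (order G) else 0)"
proof -
  let ?K = "class_rep C" and ?X = "gset_coset G (class_rep C)"
  let ?st = "stabilizer G (snd ?X)"
  note K = class_rep(1)[OF C]
  have st: "N \<subseteq> ?st x \<longleftrightarrow> N \<subseteq> ?K" "card (?st x) = card ?K" if x: "x \<in> fst ?X" for x
  proof -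
    obtain g where "g \<in> carrier G" "?st x = g <# ?K #> inv g"
      using stabilizer_coset[OF K fin x] by blast
    then show "N \<subseteq> ?st x \<longleftrightarrow> N \<subseteq> ?K" "card (?st x) = card ?K"
      using normal_subset_conjugate[OF N subgroup.subset[OF K]]
        card_conjugate[OF subgroup.subset[OF K]] by simp_all
  qed
  have "(\<Sum>H | subgroup H G \<and> N \<subseteq> H. int (card H) * coset_count C H) =
      (\<Sum>x | x \<in> fst ?X \<and> N \<subseteq> ?st x. int (card (?st x)))"
    unfolding coset_count_def
    using sum_stab_count[OF fin_gset_coset[OF K fin] fin, where P = "\<lambda>H. N \<subseteq> H"] by simp
  also have "\<dots> = (\<Sum>x | x \<in> fst ?X \<and> N \<subseteq> ?K. int (card ?K))"
    using st by (intro sum.cong) auto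
  also have "\<dots> = (if N \<subseteq> ?K then int (card (fst ?X) * card ?K) else 0)"
    by simp
  also have "card (fst ?X) * card ?K = order G"
    using l_lagrange[OF fin K] by (simp add: gset_coset_def)
  finally show ?thesis .
qed

text \<open>Burnside's orbit counting lemma for the action of \<open>G/N\<close> on the \<open>N\<close>-fixed points: each
  \<open>[G/H]\<close> with \<open>N \<subseteq> H\<close> contributes one orbit, and the others contribute none.\<close>

lemma order_mult_core_sum:
  assumes fin: "finite (carrier G)" and N: "N \<lhd> G" and f: "f \<in> virtual_counts G"
  shows "int (order G) * core_sum G N (vclass G f) =
    (\<Sum>g\<in>carrier G. \<Sum>H | subgroup H G \<and> insert g N \<subseteq> H. f H)"
proof -
  let ?S = "{H. subgroup H G \<and> N \<subseteq> H}" and ?a = "burnside_coeff G (vclass G f)"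
  have "?S \<subseteq> Pow (carrier G)"
    by (auto dest: subgroup.subset)
  then have finS: "finite ?S"
    using fin finite_subset by blast
  \<comment> \<open>Extension by zeros makes the range of \<open>H\<close> independent of
    \<open>g\<close>, so the sums can be exchanged; each \<open>H\<close> is then counted once for
    each of its elements.\<close>
  have "(\<Sum>g\<in>carrier G. \<Sum>H | subgroup H G \<and> insert g N \<subseteq> H. f H) =
      (\<Sum>g\<in>carrier G. \<Sum>H\<in>?S. if g \<in> H then f H else 0)"
    using finS by (intro sum.cong refl sum.mono_neutral_cong_left) auto
  also have "\<dots> = (\<Sum>H\<in>?S. \<Sum>g\<in>carrier G. if g \<in> H then f H else 0)"
    by (rule sum.swap)
  also have "\<dots> = (\<Sum>H\<in>?S. int (card H) * f H)"
  proof (intro sum.cong refl)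
    fix H assume "H \<in> ?S"
    then have "H \<subseteq> carrier G"
      using subgroup.subset by blast
    then show "(\<Sum>g\<in>carrier G. if g \<in> H then f H else 0) = int (card H) * f H"
      using fin by (simp add: sum.If_cases Int_absorb1)
  qed
  also have "\<dots> = (\<Sum>H\<in>?S. int (card H) * (\<Sum>C\<in>subgroup_classes G. ?a C * coset_count C H))"
    using fun_cong[OF burnside_coeff_expansion[OF fin f]] by (intro sum.cong) auto
  also have "\<dots> = (\<Sum>C\<in>subgroup_classes G. ?a C * (\<Sum>H\<in>?S. int (card H) * coset_count C H))"
    unfolding sum_distrib_left by (subst sum.swap) (simp add: mult_ac)
  also have "\<dots> = (\<Sum>C\<in>subgroup_classes G. if N \<subseteq> class_rep C then int (order G) * ?a C else 0)"
    using sum_card_coset_count[OF fin N] by (intro sum.cong) auto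
  also have "\<dots> = int (order G) * core_sum G N (vclass G f)"
    using finite_subgroup_classes[OF fin]
    by (auto simp: core_sum_eq[OF fin N] sum_distrib_left sum.inter_filter intro!: sum.cong)
  finally show ?thesis ..
qed

text \<open>A subgroup contains \<open>generate G K\<close> exactly if it contains \<open>K\<close>,
  so both index the same sum of counts.\<close>

lemma mark_generate:
  assumes fin: "finite (carrier G)" and f: "f \<in> virtual_counts G" and K: "K \<subseteq> carrier G"
  shows "mark (generate G K) (vclass G f) = (\<Sum>H | subgroup H G \<and> K \<subseteq> H. f H)"
proof -
  have "generate G K \<subseteq> H \<longleftrightarrow> K \<subseteq> H" if "subgroup H G" for H
  proof
    show "K \<subseteq> H" if "generate G K \<subseteq> H"
      using that by (auto intro: generate.incl)
  qed (use generate_subgroup_incl[OF _ that] in simp)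
  then have "{H. subgroup H G \<and> generate G K \<subseteq> H} = {H. subgroup H G \<and> K \<subseteq> H}"
    by blast
  then show ?thesis
    using mark_vclass[OF f fin generate_incl[OF K]] by simp
qed

section \<open>Triviality of the Yoshida character in terms of marks\<close>

lemma yoshida_char_trivial_iff:
  assumes fin: "finite (carrier G)" and u: "u \<in> Units (burnside_ring G)" and N: "N \<lhd> G"
  shows "yoshida_char G u N = trivial_char G N \<longleftrightarrow>
    (\<forall>g\<in>carrier G. mark (generate G (N \<union> {g})) u = mark N u)"
proof -
  let ?m = "\<lambda>g. mark (generate G (N \<union> {g})) u"
  obtain f where f: "f \<in> virtual_counts G" and uf: "u = vclass G f"
    using u by (auto simp: Units_def elim: carrier_burnsideE)
  have sub: "subgroup N G"
    using N by (rule normal_imp_subgroup)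
  have NG: "N \<subseteq> carrier G"
    using subgroup.subset[OF sub] .
  \<comment> \<open>Elements of one coset of \<open>N\<close> lie in the same subgroups above
    \<open>N\<close>, and these determine the mark. So the character is well defined on
    cosets.\<close>
  have const: "?m h = ?m g" if g: "g \<in> carrier G" and h: "h \<in> N #> g" for g h
  proof -
    obtain n where n: "n \<in> N" "h = n \<otimes> g"
      using h by (auto simp: r_coset_def)
    have nc: "n \<in> carrier G"
      using n(1) NG by blast
    have "h \<in> H \<longleftrightarrow> g \<in> H" if H: "subgroup H G" "N \<subseteq> H" for H
    proof
      assume "h \<in> H"
      then have "inv n \<otimes> h \<in> H"
        using H n(1) by (auto intro!: subgroup.m_closed subgroup.m_inv_closed)
      then show "g \<in> H"
        using n(2) nc g by (simp add: mult_inv_cancel)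
    next
      assume "g \<in> H"
      then show "h \<in> H"
        using H n by (auto intro!: subgroup.m_closed)
    qed
    then have "{H. subgroup H G \<and> N \<union> {h} \<subseteq> H} = {H. subgroup H G \<and> N \<union> {g} \<subseteq> H}"
      by blast
    moreover have "h \<in> carrier G"
      using n nc g by simp
    ultimately show ?thesis
      using mark_generate[OF fin f, of "N \<union> {h}"] mark_generate[OF fin f, of "N \<union> {g}"] NG g uf
      by simp
  qed
  have val: "the_elem ((\<lambda>h. ?m h div mark N u) ` (N #> g)) = ?m g div mark N u"
    if g: "g \<in> carrier G" for g
  proof -
    have "(\<lambda>h. ?m h div mark N u) ` (N #> g) = (\<lambda>h. ?m g div mark N u) ` (N #> g)"
      by (intro image_cong refl arg_cong[of _ _ "\<lambda>k. k div mark N u"] const[OF g])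
    also have "\<dots> = {?m g div mark N u}"
      using rcos_self[OF g sub] by blast
    finally show ?thesis
      by simp
  qed
  \<comment> \<open>Both marks are \<open>1\<close> or \<open>-1\<close>, so the integer division is
    exact and the quotient is \<open>1\<close> only for equal marks.\<close>
  have div_iff: "?m g div mark N u = 1 \<longleftrightarrow> ?m g = mark N u" if g: "g \<in> carrier G" for g
  proof -
    have "generate G (N \<union> {g}) \<subseteq> carrier G"
      using NG g by (intro generate_incl) auto
    then have "?m g = 1 \<or> ?m g = -1" "mark N u = 1 \<or> mark N u = -1"
      using mark_unit[OF u fin] NG by auto
    then show ?thesis
      by auto
  qed
  have "yoshida_char G u N = trivial_char G N \<longleftrightarrow>
      (\<forall>C\<in>carrier (G Mod N). the_elem ((\<lambda>h. ?m h div mark N u) ` C) = 1)"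
    unfolding yoshida_char_def trivial_char_def
    by (auto simp: restrict_def fun_eq_iff)
  also have "\<dots> \<longleftrightarrow> (\<forall>g\<in>carrier G. ?m g div mark N u = 1)"
    using val by (auto simp: FactGroup_def RCOSETS_def)
  also have "\<dots> \<longleftrightarrow> (\<forall>g\<in>carrier G. ?m g = mark N u)"
    using div_iff by blast
  finally show ?thesis .
qed

end

theorem theorem4p2:
  fixes G :: "('a, 'm) monoid_scheme" and u :: "'a virtual_gset" and N :: "'a set"
  assumes "group G" and "finite (carrier G)"
    and "u \<in> Units (burnside_ring G)"
    and "N \<lhd> G"
  shows "core_sum G N u =
    (if yoshida_char G u N = trivial_char G N then mark N u else 0)"
proof -
  interpret group G
    by fact
  note fin = assms(2) and u = assms(3) and N = assms(4)
  let ?m = "\<lambda>g. mark (generate G (N \<union> {g})) u"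
  obtain f where f: "f \<in> virtual_counts G" and uf: "u = vclass G f"
    using u by (auto simp: Units_def elim: carrier_burnsideE)
  have sub: "subgroup N G"
    using N by (rule normal_imp_subgroup)
  have NG: "N \<subseteq> carrier G"
    using subgroup.subset[OF sub] .
  have sum: "int (order G) * core_sum G N u = (\<Sum>g\<in>carrier G. ?m g)"
    using order_mult_core_sum[OF fin N f] mark_generate[OF fin f] NG uf by simp
  have order: "order G > 0"
    using fin by (simp add: order_gt_0_iff_finite)
  have pm: "?m g = 1 \<or> ?m g = -1" if "g \<in> carrier G" for g
    using NG that by (intro mark_unit[OF u fin] generate_incl) auto
  have "\<one>\<^bsub>G\<^esub> \<in> N"
    using subgroup.one_closed[OF sub] .
  \<comment> \<open>Adjoining the identity does not enlarge \<open>N\<close>, so the mark at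
    \<open>N\<close> is itself one of the summands.\<close>
  then have mark_N: "?m \<one>\<^bsub>G\<^esub> = mark N u"
    using mark_generate[OF fin f NG] mark_vclass[OF f fin NG] uf by (simp add: insert_absorb)
  show ?thesis
  proof (cases "\<forall>g\<in>carrier G. ?m g = mark N u")
    case True
    then have "int (order G) * core_sum G N u = int (order G) * mark N u"
      using sum by (simp add: order_def)
    then show ?thesis
      using True order yoshida_char_trivial_iff[OF fin u N] by simp
  next
    case False
    then obtain g where g: "g \<in> carrier G" "?m g \<noteq> mark N u"
      by blast
    \<comment> \<open>Hence \<open>g\<close> and the identity index two different summands, which
      can be split off one after the other.\<close>
    have "g \<noteq> \<one>\<^bsub>G\<^esub>"
      using g mark_N by auto
    have "(\<Sum>h\<in>carrier G. ?m h) = ?m g + (\<Sum>h\<in>carrier G - {g}. ?m h)"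
      using fin g by (simp add: sum.remove)
    also have "(\<Sum>h\<in>carrier G - {g}. ?m h) = ?m \<one>\<^bsub>G\<^esub> + (\<Sum>h\<in>carrier G - {g} - {\<one>\<^bsub>G\<^esub>}. ?m h)"
      using fin \<open>g \<noteq> \<one>\<^bsub>G\<^esub>\<close> by (intro sum.remove) auto
    \<comment> \<open>The marks for \<open>g\<close> and for the identity differ and are
      \<open>1\<close> or \<open>-1\<close>, so they cancel.\<close>
    finally have "(\<Sum>h\<in>carrier G. ?m h) = (\<Sum>h\<in>carrier G - {g} - {\<one>\<^bsub>G\<^esub>}. ?m h)"
      using g mark_N pm[OF g(1)] pm[OF one_closed] by auto
    also have "\<bar>\<dots>\<bar> \<le> (\<Sum>h\<in>carrier G - {g} - {\<one>\<^bsub>G\<^esub>}. \<bar>?m h\<bar>)"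
      by (rule sum_abs)
    also have "\<dots> = (\<Sum>h\<in>carrier G - {g} - {\<one>\<^bsub>G\<^esub>}. 1)"
    proof (intro sum.cong refl)
      fix h assume "h \<in> carrier G - {g} - {\<one>\<^bsub>G\<^esub>}"
      then show "\<bar>?m h\<bar> = 1"
        using pm[of h] by auto
    qed
    \<comment> \<open>Two elements have been removed, so fewer than \<open>order G\<close> summands
      of absolute value \<open>1\<close> remain.\<close>
    also have "\<dots> < int (order G)"
      using fin g order by (auto simp: order_def intro!: psubset_card_mono)
    finally have "int (order G) * \<bar>core_sum G N u\<bar> < int (order G) * 1"
      using sum by (simp add: abs_mult)
    \<comment> \<open>Integrality enters here: an integer of absolute value less than
      \<open>1\<close> vanishes.\<close>
    then have "core_sum G N u = 0"
      by (simp only: mult_less_cancel_left) auto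
    then show ?thesis
      using False yoshida_char_trivial_iff[OF fin u N] by auto
  qed
qed

end
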